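(* Let $\mathcal{F}=\{\mathcal{M},\eta,\circ\}$ be a Frobenius manifold (quasihomogeneity not being required) and let $\mathcal{N}\subset\mathcal{M}$ be a two-dimensional submanifold, with nondegenerate induced metric, such that the unity vector field at all points of $\mathcal{N}$ is tangent to $\mathcal{N}$. Then the induced structure $\mathcal{F}_{\mathcal{N}}=\{\mathcal{N},\eta_{\mathcal{N}},\star\}$ is a Frobenius manifold (again with quasihomogeneity not being required).
   Context: Frobenius manifold (without quasihomogeneity): a region $\mathcal{M}\subset\mathbb{R}^m$ (or $\mathbb{C}^m$) with coordinates $t^1,\dots,t^m$ and a function $F$ (the prepotential) on $\mathcal{M}$ whose third derivatives $c_{ijk}=\frac{\partial^3F}{\partial t^i\partial t^j\partial t^k}$ satisfy: (1) Normalization: $\eta_{ij}=c_{1ij}$ is a constant nondegenerate matrix, with inverse $\eta^{ij}$; it defines the metric $\eta=\langle\,,\rangle$. (2) Associativity: with $c_{ij}{}^{k}=\eta^{kl}c_{ijl}$, the multiplication $\frac{\partial}{\partial t^i}\circ\frac{\partial}{\partial t^j}=c_{ij}{}^{k}\frac{\partial}{\partial t^k}$ is associative and commutative on each tangent space, with unity $\mathbb{I}=\partial/\partial t^1$. Standing convention on the ambient manifold: the coordinates are such that $\eta_{ij}=\delta_{i+j,m+1}$ (antidiagonal form). Induced structure on a submanifold $\mathcal{N}$: $\eta_{\mathcal{N}}$ is the restriction of $\eta$ to $T\mathcal{N}$, and $a\star b=pr(a\circ b)$ for $a,b\in T_\tau\mathcal{N}$, where $pr:T_\tau\mathcal{M}\to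 T_\tau\mathcal{N}$ is the $\eta$-orthogonal projection. That $\mathcal{F}_{\mathcal{N}}$ is a Frobenius manifold means that (locally on $\mathcal{N}$) there are coordinates $\tau^\alpha$ on $\mathcal{N}$ and a function $F_{\mathcal{N}}(\tau)$ satisfying (1) and (2) (with $m$ replaced by $\dim\mathcal{N}$) whose associated metric, multiplication and unity $\partial/\partial\tau^1$ are $\eta_{\mathcal{N}}$, $\star$ and the unity field of $\mathcal{M}$ restricted to $\mathcal{N}$. *)

theory Defs
  imports "HOL-Analysis.Analysis"
begin

text \<open>
  Everything is stated over a scalar field \<open>'k\<close> of class \<open>real_normed_field\<close>, with \<open>deriv\<close> and
  \<open>has_derivative\<close> from the library, so that \<open>'k = real\<close> gives real smooth geometry and
  \<open>'k = complex\<close> gives holomorphic geometry. A point of \<open>'k ^ 'm\<close> has coordinates indexed by the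
  type \<open>'m\<close>; the coordinate called \<open>t\<^sup>1\<close> is singled out by an index \<open>u\<close>.
\<close>

definition partial :: "'m \<Rightarrow> ('k::real_normed_field ^ 'm \<Rightarrow> 'k) \<Rightarrow> 'k ^ 'm \<Rightarrow> 'k" where
  "partial i f x = deriv (\<lambda>h. f (x + h *s axis i 1)) 0"

text \<open>
  The Frechet derivative is required to be given by the partial derivatives, hence to be
  \<open>'k\<close>-linear: for \<open>'k = complex\<close> this is complex differentiability.
\<close>

primrec Ck_on :: "nat \<Rightarrow> ('k::real_normed_field ^ 'm::finite) set \<Rightarrow> ('k ^ 'm \<Rightarrow> 'k) \<Rightarrow> bool" where
  "Ck_on 0 S f \<longleftrightarrow> continuous_on S f"
| "Ck_on (Suc n) S f \<longleftrightarrow>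
     (\<forall>x\<in>S. (f has_derivative (\<lambda>v. \<Sum>i\<in>UNIV. partial i f x * v $ i)) (at x)) \<and>
     (\<forall>i. Ck_on n S (partial i f))"

definition smooth_on :: "('k::real_normed_field ^ 'm::finite) set \<Rightarrow> ('k ^ 'm \<Rightarrow> 'k) \<Rightarrow> bool" where
  "smooth_on S f \<longleftrightarrow> (\<forall>n. Ck_on n S f)"

definition third_deriv ::
    "('k::real_normed_field ^ 'm \<Rightarrow> 'k) \<Rightarrow> 'k ^ 'm \<Rightarrow> 'm \<Rightarrow> 'm \<Rightarrow> 'm \<Rightarrow> 'k" where
  "third_deriv F t i j k = partial i (partial j (partial k F)) t"

definition eta :: "'m \<Rightarrow> ('k::real_normed_field ^ 'm \<Rightarrow> 'k) \<Rightarrow> 'k ^ 'm \<Rightarrow> 'k ^ 'm ^ 'm" where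
  "eta u F t = (\<chi> i j. third_deriv F t u i j)"

definition eta_form ::
    "'m \<Rightarrow> ('k::real_normed_field ^ 'm::finite \<Rightarrow> 'k) \<Rightarrow> 'k ^ 'm \<Rightarrow> 'k ^ 'm \<Rightarrow> 'k ^ 'm \<Rightarrow> 'k" where
  "eta_form u F t a b = (\<Sum>i\<in>UNIV. \<Sum>j\<in>UNIV. eta u F t $ i $ j * a $ i * b $ j)"

text \<open>\<open>struct_const u F t i j k\<close> is \<open>c\<^sub>i\<^sub>j\<close> with the third index \<open>k\<close> raised.\<close>

definition struct_const ::
    "'m \<Rightarrow> ('k::real_normed_field ^ 'm::finite \<Rightarrow> 'k) \<Rightarrow> 'k ^ 'm \<Rightarrow> 'm \<Rightarrow> 'm \<Rightarrow> 'm \<Rightarrow> 'k" where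
  "struct_const u F t i j k =
     (\<Sum>l\<in>UNIV. matrix_inv (eta u F t) $ k $ l * third_deriv F t i j l)"

definition mult ::
    "'m \<Rightarrow> ('k::real_normed_field ^ 'm::finite \<Rightarrow> 'k) \<Rightarrow> 'k ^ 'm \<Rightarrow> 'k ^ 'm \<Rightarrow> 'k ^ 'm \<Rightarrow> 'k ^ 'm" where
  "mult u F t a b = (\<chi> k. \<Sum>i\<in>UNIV. \<Sum>j\<in>UNIV. a $ i * b $ j * struct_const u F t i j k)"

definition frobenius_manifold ::
    "('k::real_normed_field ^ 'm::finite) set \<Rightarrow> 'm \<Rightarrow> ('k ^ 'm \<Rightarrow> 'k) \<Rightarrow> bool" where
  "frobenius_manifold M u F \<longleftrightarrow>
     open M \<and> connected M \<and> M \<noteq> {} \<and> smooth_on M F \<and>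
     (\<exists>H. invertible H \<and> (\<forall>t\<in>M. eta u F t = H)) \<and>
     (\<forall>t\<in>M.
        (\<forall>a b c. mult u F t (mult u F t a b) c = mult u F t a (mult u F t b c)) \<and>
        (\<forall>a b. mult u F t a b = mult u F t b a) \<and>
        (\<forall>a. mult u F t (axis u 1) a = a))"

definition antidiagonal_coordinates ::
    "('m \<Rightarrow> nat) \<Rightarrow> ('k::real_normed_field ^ 'm::finite) set \<Rightarrow> 'm \<Rightarrow> ('k ^ 'm \<Rightarrow> 'k) \<Rightarrow> bool" where
  "antidiagonal_coordinates \<iota> M u F \<longleftrightarrow>
     bij_betw \<iota> UNIV {1..CARD('m)} \<and> \<iota> u = 1 \<and>
     (\<forall>t\<in>M. \<forall>i j. eta u F t $ i $ j = (if \<iota> i + \<iota> j = CARD('m) + 1 then 1 else 0))"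

definition jacobian_matrix ::
    "('k::real_normed_field ^ 'n \<Rightarrow> 'k ^ 'm) \<Rightarrow> 'k ^ 'n \<Rightarrow> 'k ^ 'n ^ 'm" where
  "jacobian_matrix \<phi> x = (\<chi> i \<alpha>. partial \<alpha> (\<lambda>y. \<phi> y $ i) x)"

text \<open>
  \<open>\<phi>\<close> is the inverse of a coordinate chart on a relatively open part of \<open>N\<close>: a smooth immersion
  that is a homeomorphism onto an open subset of \<open>N\<close>.
\<close>

definition local_parametrization ::
    "('k::real_normed_field ^ 'm::finite) set \<Rightarrow> ('k ^ 'n::finite) set \<Rightarrow> ('k ^ 'n \<Rightarrow> 'k ^ 'm) \<Rightarrow> bool"
  where
  "local_parametrization N U \<phi> \<longleftrightarrow>
     open U \<and> (\<forall>i. smooth_on U (\<lambda>x. \<phi> x $ i)) \<and>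
     (\<forall>x\<in>U. inj (\<lambda>a. jacobian_matrix \<phi> x *v a)) \<and>
     openin (top_of_set N) (\<phi> ` U) \<and> (\<exists>\<psi>. homeomorphism U (\<phi> ` U) \<phi> \<psi>)"

text \<open>The dimension of the (embedded) submanifold is \<open>CARD('n)\<close>.\<close>

definition submanifold ::
    "'n::finite itself \<Rightarrow> ('k::real_normed_field ^ 'm::finite) set \<Rightarrow> bool" where
  "submanifold _ N \<longleftrightarrow>
     (\<forall>p\<in>N. \<exists>(U :: ('k ^ 'n) set) \<phi>. local_parametrization N U \<phi> \<and> p \<in> \<phi> ` U)"

text \<open>
  The velocities at \<open>p\<close> of curves in \<open>N\<close> with parameter in \<open>'k\<close>. If \<open>N\<close> is a submanifold this is
  the image of the Jacobian of any local parametrization, and demanding smooth curves would not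
  change it.
\<close>

definition tangent_space ::
    "('k::real_normed_field ^ 'm::finite) set \<Rightarrow> 'k ^ 'm \<Rightarrow> ('k ^ 'm) set" where
  "tangent_space N p =
     {v. \<exists>\<gamma>. \<gamma> 0 = p \<and> (\<forall>\<^sub>F h in nhds 0. \<gamma> h \<in> N) \<and>
             (\<forall>i. ((\<lambda>h. \<gamma> h $ i) has_field_derivative v $ i) (at 0))}"

definition nondegenerate_on :: "'v::zero set \<Rightarrow> ('v \<Rightarrow> 'v \<Rightarrow> 'k::zero) \<Rightarrow> bool" where
  "nondegenerate_on T g \<longleftrightarrow> (\<forall>a\<in>T. (\<forall>b\<in>T. g a b = 0) \<longrightarrow> a = 0)"

definition orthogonal_proj :: "'v::minus set \<Rightarrow> ('v \<Rightarrow> 'v \<Rightarrow> 'k::zero) \<Rightarrow> 'v \<Rightarrow> 'v" where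
  "orthogonal_proj T g v = (THE w. w \<in> T \<and> (\<forall>b\<in>T. g (v - w) b = 0))"

definition induced_mult ::
    "'m \<Rightarrow> ('k::real_normed_field ^ 'm::finite \<Rightarrow> 'k) \<Rightarrow> ('k ^ 'm) set \<Rightarrow> 'k ^ 'm \<Rightarrow>
     'k ^ 'm \<Rightarrow> 'k ^ 'm \<Rightarrow> 'k ^ 'm" where
  "induced_mult u F N p a b =
     orthogonal_proj (tangent_space N p) (eta_form u F p) (mult u F p a b)"

text \<open>
  Around every point of \<open>N\<close> there are coordinates \<open>\<tau>\<close> (the inverse of \<open>\<phi>\<close>) and a prepotential
  \<open>G\<close> in these coordinates, \<open>\<tau>\<^sup>1\<close> having index \<open>w\<close>, such that the differential of \<open>\<phi>\<close> carries the
  metric, multiplication and unity defined by \<open>G\<close> to the metric, induced multiplication and unity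
  on \<open>N\<close>.
\<close>

definition induced_frobenius_manifold ::
    "'m \<Rightarrow> ('k::real_normed_field ^ 'm::finite \<Rightarrow> 'k) \<Rightarrow> ('k ^ 'm) set \<Rightarrow> 'n::finite \<Rightarrow> bool" where
  "induced_frobenius_manifold u F N w \<longleftrightarrow>
     (\<forall>p\<in>N. \<exists>(U :: ('k ^ 'n) set) \<phi> G.
        local_parametrization N U \<phi> \<and> p \<in> \<phi> ` U \<and> frobenius_manifold U w G \<and>
        (\<forall>x\<in>U.
           let d\<phi> = (\<lambda>a. jacobian_matrix \<phi> x *v a) in
             (\<forall>a b. eta_form u F (\<phi> x) (d\<phi> a) (d\<phi> b) = eta_form w G x a b) \<and>
             (\<forall>a b. induced_mult u F N (\<phi> x) (d\<phi> a) (d\<phi> b) = d\<phi> (mult w G x a b)) \<and>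
             d\<phi> (axis w 1) = axis u 1))"

end

theory Submission
  imports Defs
begin

text \<open>
  Write \<open>e = \<partial>/\<partial>t\<^sup>1\<close> for the unity, \<open>\<eta>\<close> for the metric and \<open>c(a, b, d) = \<eta>(a \<circ> b, d)\<close> for the symmetric
  cubic form with components \<open>c\<^sub>i\<^sub>j\<^sub>k\<close>. Everything on \<open>N\<close> turns out to depend on a single coordinate,
  and a Frobenius structure on a surface is nothing but one function of one coordinate.

  In antidiagonal coordinates \<open>\<eta>(e, b)\<close> is the last component \<open>t\<^sup>m\<close> of \<open>b\<close>. As \<open>m \<ge> 2\<close>, the vector \<open>e\<close> is
  null, and nondegeneracy of \<open>\<eta>\<close> on the tangent planes of \<open>N\<close> says that \<open>dt\<^sup>m\<close> does not vanish on them,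
  whereas \<open>dt\<^sup>1(e) = 1\<close> and \<open>dt\<^sup>m(e) = 0\<close>. So \<open>(t\<^sup>1, t\<^sup>m)\<close> are local coordinates on \<open>N\<close> by the inverse
  function theorem (\<open>graph_parametrization\<close>), and in them \<open>e\<close> is the first coordinate field
  (\<open>unity_in_graph_parametrization\<close>): \<open>N\<close> is locally swept out by lines parallel to \<open>e\<close>. Along these
  lines \<open>\<eta>\<close> and all \<open>c\<^sub>i\<^sub>j\<^sub>k\<close> are constant, the latter because \<open>\<partial>\<^sub>1 c\<^sub>i\<^sub>j\<^sub>k = \<partial>\<^sub>i c\<^sub>1\<^sub>j\<^sub>k = \<partial>\<^sub>i \<eta>\<^sub>j\<^sub>k = 0\<close>
  (\<open>third_deriv_constant_along_unity\<close>, \<open>c_form_constant_along_unity\<close>).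

  If \<open>w\<close> is the second coordinate field, then \<open>\<eta>(e, e) = 0\<close>, \<open>\<eta>(e, w) = 1\<close>, and \<open>\<eta>(w, w) = h\<close> is a function
  of the second coordinate alone. Shearing the parametrization in the direction \<open>e\<close> by a primitive of \<open>- h / 2\<close>
  makes \<open>w\<close> null as well (\<open>null_parametrization\<close>), so that the induced metric becomes constant.

  In such coordinates \<open>\<tau>\<^sup>1, \<tau>\<^sup>2\<close> the cubic form is determined by \<open>\<eta>\<close> through \<open>c(e, a, b) = \<eta>(a, b)\<close>, except
  for \<open>c(w, w, w)\<close>, which is a function of \<open>\<tau>\<^sup>2\<close> (\<open>c_form_null_frame\<close>). With a threefold primitive \<open>C\<close> of
  this function, \<open>G = (\<tau>\<^sup>1)\<^sup>2 \<tau>\<^sup>2 / 2 + C(\<tau>\<^sup>2)\<close> has exactly these third derivatives, and its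
  multiplication is associative since a commutative algebra with basis \<open>1, w\<close> is
  generated by the one element \<open>w\<close> (\<open>exists_prepotential_2\<close>). Finally
  \<open>\<eta>(pr(a \<circ> b), d) = \<eta>(a \<circ> b, d) = c(a, b, d)\<close> for tangent \<open>d\<close>, so by nondegeneracy the product \<open>\<star>\<close> is the one
  defined by \<open>G\<close>.

  The scalar field may be real or complex. Therefore differentiation is always along
  coordinate axes over \<open>'k\<close>, and primitives are integrals over segments, which exist on
  convex sets in both cases.
\<close>

section \<open>Calculus of functions of class \<open>C\<^sup>k\<close>\<close>

lemma norm_axis: "norm (axis i x :: 'b::real_normed_vector ^ 'n::finite) = norm x"
proof -
  have "(norm ((axis i x :: 'b ^ 'n) $ j))\<^sup>2 = (if j = i then (norm x)\<^sup>2 else 0)" for j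
    by (simp add: axis_def)
  then show ?thesis
    by (simp add: norm_vec_def L2_set_def)
qed

lemma bounded_linear_axis:
  "bounded_linear (axis i :: 'b::real_normed_vector \<Rightarrow> 'b ^ 'n::finite)"
proof (rule bounded_linear_intro[where K = 1])
  fix x y :: 'b and r :: real
  show "axis i (x + y) = (axis i x + axis i y :: 'b ^ 'n)"
    by (simp add: vec_eq_iff axis_def)
  show "axis i (r *\<^sub>R x) = (r *\<^sub>R axis i x :: 'b ^ 'n)"
    by (simp add: vec_eq_iff axis_def)
  show "norm (axis i x :: 'b ^ 'n) \<le> norm x * 1"
    by (simp add: norm_axis)
qed

lemma axis_0: "axis i 0 = (0 :: 'b::zero ^ 'n)"
  by (simp add: vec_eq_iff axis_def)

lemma scale_axis: "h *s axis j 1 = (axis j h :: 'k::semiring_1 ^ 'a)"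
  by (auto simp: vec_eq_iff axis_def)

lemma sum_mult_axis: "(\<Sum>i\<in>UNIV. a i * (axis j h :: 'k::semiring_1 ^ 'a::finite) $ i) = a j * h"
  by (simp add: axis_def if_distrib[of "\<lambda>x. _ * x"] cong: if_cong)

text \<open>
  At \<open>s = 0\<close> this computes partial derivatives (\<open>partial_eqI\<close>); at the other points of the line it
  reduces mean value and constancy arguments to one variable.
\<close>
lemma DERIV_along_axis:
  fixes f :: "'k::real_normed_field ^ 'a::finite \<Rightarrow> 'k"
  assumes "(f has_derivative (\<lambda>v. \<Sum>i\<in>UNIV. a i * v $ i)) (at (y + axis j s))"
  shows "((\<lambda>s. f (y + axis j s)) has_field_derivative a j) (at s)"
proof -
  have "((\<lambda>s. y + axis j s) has_derivative axis j) (at s)"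
    by (auto intro!: derivative_eq_intros bounded_linear_imp_has_derivative bounded_linear_axis)
  from has_derivative_compose[OF this assms]
  show ?thesis
    by (simp add: has_field_derivative_def sum_mult_axis)
qed

lemma partial_eqI:
  fixes f :: "'k::real_normed_field ^ 'a::finite \<Rightarrow> 'k"
  assumes "(f has_derivative (\<lambda>v. \<Sum>i\<in>UNIV. a i * v $ i)) (at x)"
  shows "partial j f x = a j"
proof -
  have "((\<lambda>s. f (x + axis j s)) has_field_derivative a j) (at 0)"
    by (rule DERIV_along_axis) (simp only: axis_0 add_0_right assms)
  then show ?thesis
    unfolding partial_def scale_axis by (rule DERIV_imp_deriv)
qed

lemma partial_cong_open:
  fixes f :: "'k::real_normed_field ^ 'a::finite \<Rightarrow> 'k"
  assumes "open S" "x \<in> S" "\<And>y. y \<in> S \<Longrightarrow> f y = g y"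
  shows "partial i f x = partial i g x"
proof -
  have "isCont (\<lambda>h. x + axis i h) 0"
    by (intro continuous_intros bounded_linear.continuous[OF bounded_linear_axis])
  then have "((\<lambda>h. x + axis i h) \<longlongrightarrow> x) (nhds 0)"
    unfolding isCont_def tendsto_at_iff_tendsto_nhds[of "\<lambda>h. x + axis i h"] by (simp add: axis_0)
  then have "\<forall>\<^sub>F h in nhds 0. x + h *s axis i 1 \<in> S"
    unfolding scale_axis using assms(1,2) by (rule topological_tendstoD)
  then show ?thesis
    unfolding partial_def using assms(3) by (intro deriv_cong_ev) (auto elim!: eventually_mono)
qed

lemma has_derivative_vecI:
  fixes f :: "'a::real_normed_vector \<Rightarrow> 'b::real_normed_vector ^ 'n::finite"
  assumes "\<And>i. ((\<lambda>x. f x $ i) has_derivative (\<lambda>v. f' v $ i)) F"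
  shows "(f has_derivative f') F"
proof -
  have e: "y = (\<Sum>i\<in>UNIV. axis i (y $ i))" for y :: "'b ^ 'n"
    by (simp add: vec_eq_iff axis_def)
  have "((\<lambda>x. \<Sum>i\<in>UNIV. axis i (f x $ i)) has_derivative (\<lambda>v. \<Sum>i\<in>UNIV. axis i (f' v $ i))) F"
    by (intro has_derivative_sum bounded_linear.has_derivative[OF bounded_linear_axis] assms)
  then show ?thesis unfolding e[symmetric] .
qed

lemma has_derivative_nth:
  "(f has_derivative f') F \<Longrightarrow> ((\<lambda>x. f x $ i) has_derivative (\<lambda>v. f' v $ i)) F"
  by (rule bounded_linear.has_derivative[OF bounded_linear_vec_nth])

text \<open>
  The definition of \<open>Ck_on\<close> refers to the values of a function near \<open>S\<close>, which for open \<open>S\<close> means on \<open>S\<close>. Hence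
  partial derivatives may be replaced by any functions that agree with them on \<open>S\<close>.
\<close>
lemma Ck_on_cong:
  fixes f :: "'k::real_normed_field ^ 'a::finite \<Rightarrow> 'k"
  assumes "open S" "Ck_on n S f" "\<And>x. x \<in> S \<Longrightarrow> f x = g x"
  shows "Ck_on n S g"
  using assms(2,3)
proof (induction n arbitrary: f g)
  case 0
  then show ?case using continuous_on_cong[of S S f g] by simp
next
  case (Suc n)
  have der: "(g has_derivative (\<lambda>v. \<Sum>i\<in>UNIV. partial i f x * v $ i)) (at x)" if "x \<in> S" for x
    using Suc.prems that by (auto intro: has_derivative_transform_within_open[OF _ assms(1)])
  have p: "partial i f x = partial i g x" if "x \<in> S" for i x
    using partial_eqI[OF der[OF that], of i] by simp
  have "Ck_on n S (partial i g)" for i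
    by (rule Suc.IH[of "partial i f"]) (use Suc.prems(1) p in simp_all)
  then show ?case using der p by simp
qed

text \<open>
  The closure properties of \<open>Ck_on\<close> all follow by induction from this rule: it suffices to exhibit
  the total derivative and to see that its coefficients are built from functions of class \<open>C\<^sup>n\<close>.
\<close>
lemma Ck_on_SucI:
  fixes f :: "'k::real_normed_field ^ 'a::finite \<Rightarrow> 'k"
  assumes "open S"
    and der: "\<And>x. x \<in> S \<Longrightarrow> (f has_derivative (\<lambda>v. \<Sum>i\<in>UNIV. g i x * v $ i)) (at x)"
    and ck: "\<And>i. Ck_on n S (g i)"
  shows "Ck_on (Suc n) S f"
proof -
  have p: "g i x = partial i f x" if "x \<in> S" for x i
    using partial_eqI[OF der[OF that]] by simp
  have "Ck_on n S (partial i f)" for i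
    by (rule Ck_on_cong[OF assms(1) ck[of i]]) (rule p)
  then show ?thesis using der p by simp
qed

lemma Ck_on_Suc_imp:
  fixes f :: "'k::real_normed_field ^ 'a::finite \<Rightarrow> 'k"
  shows "Ck_on (Suc n) S f \<Longrightarrow> Ck_on n S f"
proof (induction n arbitrary: f)
  case 0
  have "isCont f x" if "x \<in> S" for x
    by (rule has_derivative_continuous) (use 0 that in auto)
  then show ?case by (simp add: continuous_at_imp_continuous_on)
next
  case (Suc n)
  have "Ck_on n S (partial i f)" for i
    by (rule Suc.IH) (use Suc.prems in simp)
  then show ?case using Suc.prems by simp
qed

lemma Ck_on_const:
  fixes c :: "'k::real_normed_field"
  assumes "open S" shows "Ck_on n (S :: ('k ^ 'a::finite) set) (\<lambda>x. c)"
proof (induction n arbitrary: c)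
  case (Suc n)
  show ?case by (rule Ck_on_SucI[OF assms, of _ "\<lambda>i x. 0"]) (use assms Suc in auto)
qed (auto intro: continuous_intros)

lemma Ck_on_nth:
  assumes "open S" shows "Ck_on n (S :: ('k::real_normed_field ^ 'a::finite) set) (\<lambda>x. x $ j)"
proof (cases n)
  case (Suc n)
  have "(\<Sum>i\<in>UNIV. (if i = j then 1 else 0) * v $ i) = v $ j" for v :: "'k ^ 'a"
    by (simp add: if_distrib[of "\<lambda>x. x * _"] cong: if_cong)
  then show ?thesis unfolding Suc
    by (intro Ck_on_SucI[OF assms, of _ "\<lambda>i x. if i = j then 1 else 0"])
      (auto intro: assms Ck_on_const bounded_linear_imp_has_derivative bounded_linear_vec_nth)
qed (auto intro: continuous_intros)

lemma Ck_on_add: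
  fixes f :: "'k::real_normed_field ^ 'a::finite \<Rightarrow> 'k"
  assumes "open S"
  shows "Ck_on n S f \<Longrightarrow> Ck_on n S g \<Longrightarrow> Ck_on n S (\<lambda>x. f x + g x)"
proof (induction n arbitrary: f g)
  case (Suc n)
  show ?case
  proof (rule Ck_on_SucI[OF assms, of _ "\<lambda>i x. partial i f x + partial i g x"])
    fix x assume "x \<in> S"
    then show "((\<lambda>x. f x + g x) has_derivative (\<lambda>v. \<Sum>i\<in>UNIV. (partial i f x + partial i g x) * v $ i)) (at x)"
      using Suc.prems by (auto intro!: derivative_eq_intros simp: sum.distrib algebra_simps)
  qed (use assms Suc in auto)
qed (auto intro: continuous_intros)

lemma Ck_on_mult:
  fixes f :: "'k::real_normed_field ^ 'a::finite \<Rightarrow> 'k"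
  assumes "open S"
  shows "Ck_on n S f \<Longrightarrow> Ck_on n S g \<Longrightarrow> Ck_on n S (\<lambda>x. f x * g x)"
proof (induction n arbitrary: f g)
  case (Suc n)
  show ?case
  proof (rule Ck_on_SucI[OF assms, of _ "\<lambda>i x. f x * partial i g x + partial i f x * g x"])
    fix x assume x: "x \<in> S"
    have "((\<lambda>x. f x * g x) has_derivative (\<lambda>v. f x * (\<Sum>i\<in>UNIV. partial i g x * v $ i) +
        (\<Sum>i\<in>UNIV. partial i f x * v $ i) * g x)) (at x)"
      using Suc.prems x by (intro has_derivative_mult) auto
    then show "((\<lambda>x. f x * g x) has_derivative (\<lambda>v. \<Sum>i\<in>UNIV. (f x * partial i g x + partial i f x * g x) * v $ i)) (at x)"
      by (simp add: sum.distrib algebra_simps sum_distrib_left sum_distrib_right)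
  next
    fix i
    have "Ck_on n S f" "Ck_on n S g" using Suc.prems Ck_on_Suc_imp by blast+
    then show "Ck_on n S (\<lambda>x. f x * partial i g x + partial i f x * g x)"
      using Suc by (intro Ck_on_add[OF assms] Suc.IH) auto
  qed
qed (auto intro: continuous_intros)

lemma Ck_on_sum:
  fixes f :: "'b \<Rightarrow> 'k::real_normed_field ^ 'a::finite \<Rightarrow> 'k"
  assumes "open S" "\<And>i. i \<in> I \<Longrightarrow> Ck_on n S (f i)"
  shows "Ck_on n S (\<lambda>x. \<Sum>i\<in>I. f i x)"
  using assms(2)
proof (induction I rule: infinite_finite_induct)
  case (insert i I)
  have "Ck_on n S (\<lambda>x. f i x + (\<Sum>i\<in>I. f i x))"
    using insert by (intro Ck_on_add[OF assms(1)]) simp_all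
  then show ?case using insert.hyps by simp
qed (simp_all add: Ck_on_const[OF assms(1)])

lemma Ck_on_inverse:
  fixes f :: "'k::real_normed_field ^ 'a::finite \<Rightarrow> 'k"
  assumes "open S" and nz: "\<And>x. x \<in> S \<Longrightarrow> f x \<noteq> 0"
  shows "Ck_on n S f \<Longrightarrow> Ck_on n S (\<lambda>x. inverse (f x))"
proof (induction n)
  case (Suc n)
  show ?case
  proof (rule Ck_on_SucI[OF assms(1), of _ "\<lambda>i x. (-1) * (inverse (f x) * (inverse (f x) * partial i f x))"])
    fix x assume x: "x \<in> S"
    have "((\<lambda>x. inverse (f x)) has_derivative
      (\<lambda>v. - (inverse (f x) * (\<Sum>i\<in>UNIV. partial i f x * v $ i) * inverse (f x)))) (at x)"
      using Suc.prems x nz by (intro Deriv.has_derivative_inverse) auto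
    then show "((\<lambda>x. inverse (f x)) has_derivative
      (\<lambda>v. \<Sum>i\<in>UNIV. (-1) * (inverse (f x) * (inverse (f x) * partial i f x)) * v $ i)) (at x)"
      by (simp add: algebra_simps sum_distrib_left sum_distrib_right sum_negf)
  next
    fix i
    have "Ck_on n S (\<lambda>x. inverse (f x))" using Suc Ck_on_Suc_imp by blast
    then show "Ck_on n S (\<lambda>x. (-1) * (inverse (f x) * (inverse (f x) * partial i f x)))"
      using Suc.prems by (intro Ck_on_mult[OF assms(1)] Ck_on_const[OF assms(1)]) auto
  qed
qed (use nz in \<open>auto intro: continuous_intros\<close>)

lemma has_derivative_compose_components:
  fixes f :: "'k::real_normed_field ^ 'a::finite \<Rightarrow> 'k ^ 'b::finite"
  assumes "(G has_derivative (\<lambda>v. \<Sum>l\<in>UNIV. dG l * v $ l)) (at (f x))"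
    and "\<And>l. ((\<lambda>x. f x $ l) has_derivative (\<lambda>v. \<Sum>i\<in>UNIV. df i l * v $ i)) (at x)"
  shows "((\<lambda>x. G (f x)) has_derivative (\<lambda>v. \<Sum>i\<in>UNIV. (\<Sum>l\<in>UNIV. dG l * df i l) * v $ i)) (at x)"
proof -
  have "(f has_derivative (\<lambda>v. \<chi> l. \<Sum>i\<in>UNIV. df i l * v $ i)) (at x)"
    by (rule has_derivative_vecI) (use assms(2) in simp)
  from has_derivative_compose[OF this assms(1)]
  have "((\<lambda>x. G (f x)) has_derivative (\<lambda>v. \<Sum>l\<in>UNIV. \<Sum>i\<in>UNIV. dG l * df i l * v $ i)) (at x)"
    by (simp add: sum_distrib_left mult.assoc)
  then show ?thesis
    by (subst (asm) sum.swap) (simp add: sum_distrib_right)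
qed

lemma Ck_on_compose:
  fixes f :: "'k::real_normed_field ^ 'a::finite \<Rightarrow> 'k ^ 'b::finite"
  assumes "open S" "f ` S \<subseteq> T"
  shows "Ck_on n T G \<Longrightarrow> (\<And>i. Ck_on n S (\<lambda>x. f x $ i)) \<Longrightarrow> Ck_on n S (\<lambda>x. G (f x))"
proof (induction n arbitrary: G)
  case 0
  have "continuous_on S (\<lambda>x. \<chi> i. f x $ i)"
    using 0 by (intro continuous_on_vec_lambda) auto
  then have "continuous_on S f" by simp
  from continuous_on_compose2[OF _ this assms(2)] show ?case using 0(1) by simp
next
  case (Suc n)
  show ?case
  proof (rule Ck_on_SucI[OF assms(1), of _ "\<lambda>i x. \<Sum>l\<in>UNIV. partial l G (f x) * partial i (\<lambda>x. f x $ l) x"])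
    fix x assume "x \<in> S"
    then show "((\<lambda>x. G (f x)) has_derivative
      (\<lambda>v. \<Sum>i\<in>UNIV. (\<Sum>l\<in>UNIV. partial l G (f x) * partial i (\<lambda>x. f x $ l) x) * v $ i)) (at x)"
      using Suc.prems assms(2) by (intro has_derivative_compose_components) auto
  next
    fix i
    have f: "Ck_on n S (\<lambda>x. f x $ i)" for i using Suc.prems(2) Ck_on_Suc_imp by blast
    have "Ck_on n S (\<lambda>x. partial l G (f x))" for l
      by (rule Suc.IH) (use Suc.prems(1) f in simp_all)
    then show "Ck_on n S (\<lambda>x. \<Sum>l\<in>UNIV. partial l G (f x) * partial i (\<lambda>x. f x $ l) x)"
      using Suc.prems(2) by (intro Ck_on_sum[OF assms(1)] Ck_on_mult[OF assms(1)]) simp_all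
  qed
qed

section \<open>Symmetry of second partial derivatives\<close>

text \<open>
  Subtracting the linear part \<open>s * (h * L)\<close> of the increment in direction \<open>i\<close>, one is left with a function
  \<open>q\<close> of the increment \<open>s\<close> in direction \<open>j\<close> whose derivative is \<open>o(h)\<close> by total differentiability of \<open>partial j f\<close>
  at \<open>x\<close>. The mean value inequality on the disc \<open>norm s \<le> norm h\<close> in the scalar field then bounds \<open>q h - q 0\<close>
  by \<open>o(h\<^sup>2)\<close>. The argument is the same over the real and the complex numbers.
\<close>
lemma second_difference_tendsto:
  fixes f :: "'k::real_normed_field ^ 'a::finite \<Rightarrow> 'k"
  assumes "open S" "x \<in> S" "Ck_on 2 S f"
  shows "((\<lambda>h. (f (x + axis i h + axis j h) - f (x + axis i h) - f (x + axis j h) + f x) / (h * h))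
           \<longlongrightarrow> partial i (partial j f) x) (at 0)"
proof (rule LIM_I)
  fix r :: real assume "r > 0"
  define g where "g = partial j f"
  define D where "D = (\<lambda>v. \<Sum>k\<in>UNIV. partial k g x * v $ k)"
  define L where "L = partial i g x"
  define \<epsilon> where "\<epsilon> = r / 4"
  have "\<epsilon> > 0" using \<open>r > 0\<close> by (simp add: \<epsilon>_def)
  have f': "(f has_derivative (\<lambda>v. \<Sum>k\<in>UNIV. partial k f y * v $ k)) (at y)" if "y \<in> S" for y
    using assms(3) that by (simp add: numeral_2_eq_2)
  have g': "(g has_derivative D) (at x)"
    using assms(2,3) by (simp add: numeral_2_eq_2 g_def D_def)
  then interpret D: bounded_linear D by (rule has_derivative_bounded_linear)
  obtain \<delta>1 where \<delta>1: "\<delta>1 > 0" "\<And>y. norm (y - x) < \<delta>1 \<Longrightarrow> norm (g y - g x - D (y - x)) \<le> \<epsilon> * norm (y - x)"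
    using g' \<open>\<epsilon> > 0\<close> unfolding has_derivative_at_alt by blast
  obtain \<delta>2 where \<delta>2: "\<delta>2 > 0" "ball x \<delta>2 \<subseteq> S"
    using assms(1,2) openE by blast
  define \<delta> where "\<delta> = min \<delta>1 \<delta>2"
  have inS: "x + v \<in> S" if "norm v < \<delta>" for v
    using that \<delta>2(2) by (auto simp: \<delta>_def dist_norm subset_eq)
  have gx: "norm (g (x + v) - g x - D v) \<le> \<epsilon> * norm v" if "norm v < \<delta>" for v
    using \<delta>1(2)[of "x + v"] that by (simp add: \<delta>_def)
  show "\<exists>s>0. \<forall>h. h \<noteq> 0 \<and> norm (h - 0) < s \<longrightarrow>
      norm ((f (x + axis i h + axis j h) - f (x + axis i h) - f (x + axis j h) + f x) / (h * h)
        - partial i (partial j f) x) < r"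
  proof (intro exI[of _ "\<delta> / 2"] conjI allI impI)
    show "\<delta> / 2 > 0" using \<delta>1 \<delta>2 by (simp add: \<delta>_def)
    fix h :: 'k assume "h \<noteq> 0 \<and> norm (h - 0) < \<delta> / 2"
    then have h: "h \<noteq> 0" "norm h < \<delta> / 2" by auto
    define q where "q = (\<lambda>s. f (x + axis i h + axis j s) - f (x + axis j s) - s * (h * L))"
    define q' where "q' = (\<lambda>s. g (x + axis i h + axis j s) - g (x + axis j s) - h * L)"
    have n: "norm (axis i h + axis j s :: 'k ^ 'a) \<le> 2 * norm h" "norm (axis j s :: 'k ^ 'a) \<le> norm h"
      if "norm s \<le> norm h" for s
      using that norm_triangle_ineq[of "axis i h :: 'k ^ 'a" "axis j s"] by (auto simp: norm_axis)
    have q': "(q has_field_derivative q' s) (at s)" and bd: "norm (q' s) \<le> 3 * \<epsilon> * norm h"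
      if s: "norm s \<le> norm h" for s
    proof -
      have "x + axis i h + axis j s \<in> S" "x + axis j s \<in> S"
        using inS[of "axis i h + axis j s"] inS[of "axis j s"] n[OF s] h norm_ge_zero[of h]
        by (simp_all add: add.assoc del: norm_ge_zero)
      then show "(q has_field_derivative q' s) (at s)"
        unfolding q_def q'_def g_def
        by (auto intro!: derivative_eq_intros DERIV_along_axis f')
      have lin: "D (axis i h + axis j s) - D (axis j s) = h * L"
        by (simp add: D.add) (simp add: D_def sum_mult_axis L_def mult.commute)
      have "q' s = (g (x + (axis i h + axis j s)) - g x - D (axis i h + axis j s)) -
                   (g (x + axis j s) - g x - D (axis j s))"
        unfolding q'_def using lin by (simp add: add.assoc algebra_simps)
      also have "norm \<dots> \<le> \<epsilon> * norm (axis i h + axis j s :: 'k ^ 'a) + \<epsilon> * norm (axis j s :: 'k ^ 'a)"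
        by (rule order.trans[OF norm_triangle_ineq4], intro add_mono gx)
          (use n[OF s] h norm_ge_zero[of h] in linarith)+
      also have "\<dots> \<le> \<epsilon> * (2 * norm h) + \<epsilon> * norm h"
        using n[OF s] \<open>\<epsilon> > 0\<close> by (intro add_mono mult_left_mono) auto
      finally show "norm (q' s) \<le> 3 * \<epsilon> * norm h" by simp
    qed
    have "norm (q h - q 0) \<le> 3 * \<epsilon> * norm h * norm (h - 0)"
      by (rule field_differentiable_bound[of "cball 0 (norm h)" q q'])
         (use q' bd in \<open>auto intro: has_field_derivative_at_within\<close>)
    moreover have "q h - q 0 = (f (x + axis i h + axis j h) - f (x + axis i h) - f (x + axis j h) + f x) - h * h * L"
      by (simp add: q_def axis_0)
    ultimately have "norm ((f (x + axis i h + axis j h) - f (x + axis i h) - f (x + axis j h) + f x) - h * h * L)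
      \<le> 3 * \<epsilon> * (norm h * norm h)" by (simp add: mult.assoc)
    then have "norm (((f (x + axis i h + axis j h) - f (x + axis i h) - f (x + axis j h) + f x) - h * h * L) / (h * h))
      \<le> 3 * \<epsilon>" using h(1) by (simp add: norm_divide norm_mult divide_le_eq)
    also have "3 * \<epsilon> < r" using \<open>r > 0\<close> by (simp add: \<epsilon>_def)
    finally show "norm ((f (x + axis i h + axis j h) - f (x + axis i h) - f (x + axis j h) + f x) / (h * h)
        - partial i (partial j f) x) < r"
      using h(1) by (simp add: diff_divide_distrib L_def g_def)
  qed
qed

text \<open>
  The second difference is symmetric in \<open>i\<close> and \<open>j\<close>, hence so is its limit.
\<close>
lemma partial_commute:
  fixes f :: "'k::real_normed_field ^ 'a::finite \<Rightarrow> 'k"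
  assumes "open S" "x \<in> S" "Ck_on 2 S f"
  shows "partial i (partial j f) x = partial j (partial i f) x"
proof (rule tendsto_unique)
  show "((\<lambda>h. (f (x + axis i h + axis j h) - f (x + axis i h) - f (x + axis j h) + f x) / (h * h))
           \<longlongrightarrow> partial i (partial j f) x) (at 0)"
    by (rule second_difference_tendsto[OF assms])
  have "f (x + axis j h + axis i h) - f (x + axis j h) - f (x + axis i h) + f x
      = f (x + axis i h + axis j h) - f (x + axis i h) - f (x + axis j h) + f x" for h
    by (simp add: add.commute add.left_commute)
  with second_difference_tendsto[OF assms, of j i]
  show "((\<lambda>h. (f (x + axis i h + axis j h) - f (x + axis i h) - f (x + axis j h) + f x) / (h * h))
           \<longlongrightarrow> partial j (partial i f) x) (at 0)" by (simp only:)
qed (rule at_neq_bot)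

section \<open>Smooth functions\<close>

lemma smooth_onD:
  "smooth_on S f \<Longrightarrow> x \<in> S \<Longrightarrow> (f has_derivative (\<lambda>v. \<Sum>i\<in>UNIV. partial i f x * v $ i)) (at x)"
proof -
  assume "smooth_on S f" "x \<in> S"
  then have "Ck_on (Suc 0) S f" unfolding smooth_on_def by blast
  with \<open>x \<in> S\<close> show ?thesis by simp
qed

lemma smooth_on_partial: "smooth_on S f \<Longrightarrow> smooth_on S (partial i f)"
  unfolding smooth_on_def
proof
  fix n assume "\<forall>n. Ck_on n S f"
  then have "Ck_on (Suc n) S f" by blast
  then show "Ck_on n S (partial i f)" by simp
qed

lemma smooth_onI:
  assumes "open S"
    and "\<And>x. x \<in> S \<Longrightarrow> (f has_derivative (\<lambda>v. \<Sum>i\<in>UNIV. g i x * v $ i)) (at x)"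
    and "\<And>i. smooth_on S (g i)"
  shows "smooth_on S f"
  unfolding smooth_on_def
proof
  fix n
  have "Ck_on (Suc n) S f"
    by (rule Ck_on_SucI) (use assms in \<open>auto simp: smooth_on_def\<close>)
  then show "Ck_on n S f" by (rule Ck_on_Suc_imp)
qed

lemma smooth_on_const: "open S \<Longrightarrow> smooth_on S (\<lambda>x. c)"
  and smooth_on_nth: "open S \<Longrightarrow> smooth_on S (\<lambda>x. x $ j)"
  and smooth_on_add: "open S \<Longrightarrow> smooth_on S f \<Longrightarrow> smooth_on S g \<Longrightarrow> smooth_on S (\<lambda>x. f x + g x)"
  and smooth_on_mult: "open S \<Longrightarrow> smooth_on S f \<Longrightarrow> smooth_on S g \<Longrightarrow> smooth_on S (\<lambda>x. f x * g x)"
  by (simp_all add: smooth_on_def Ck_on_const Ck_on_nth Ck_on_add Ck_on_mult)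

lemma smooth_on_compose:
  "open S \<Longrightarrow> f ` S \<subseteq> T \<Longrightarrow> smooth_on T G \<Longrightarrow> (\<And>i. smooth_on S (\<lambda>x. f x $ i)) \<Longrightarrow> smooth_on S (\<lambda>x. G (f x))"
  unfolding smooth_on_def
  by (intro allI, rule Ck_on_compose) blast+

lemma smooth_on_subset:
  assumes "smooth_on T f" "S \<subseteq> T"
  shows "smooth_on S f"
proof -
  have "Ck_on n T f \<Longrightarrow> Ck_on n S f" for n
    using assms(2) by (induction n arbitrary: f) (auto intro: continuous_on_subset)
  then show ?thesis using assms(1) by (simp add: smooth_on_def)
qed

lemma smooth_on_partial_commute:
  "open S \<Longrightarrow> smooth_on S f \<Longrightarrow> x \<in> S \<Longrightarrow> partial i (partial j f) x = partial j (partial i f) x"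
  unfolding smooth_on_def by (rule partial_commute) blast+

lemma partial_const_on:
  assumes "open S" "x \<in> S" "\<And>y. y \<in> S \<Longrightarrow> f y = c"
  shows "partial i f x = 0"
proof -
  have "partial i f x = partial i (\<lambda>y. c) x"
    by (rule partial_cong_open[OF assms(1,2)]) (rule assms(3))
  also have "\<dots> = 0"
    by (rule partial_eqI[of _ "\<lambda>i. 0"]) simp
  finally show ?thesis .
qed

section \<open>Parametrizations and tangent spaces\<close>

lemma has_derivative_jacobian:
  assumes "\<And>i. smooth_on U (\<lambda>x. \<phi> x $ i)" "x \<in> U"
  shows "(\<phi> has_derivative (\<lambda>v. jacobian_matrix \<phi> x *v v)) (at x)"
  by (rule has_derivative_vecI)
     (simp add: jacobian_matrix_def matrix_vector_mult_def smooth_onD[OF assms])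

lemma jacobian_matrix_eqI:
  assumes "(\<phi> has_derivative (\<lambda>v. A *v v)) (at x)"
  shows "jacobian_matrix \<phi> x = A"
proof -
  have "partial \<alpha> (\<lambda>y. \<phi> y $ i) x = A $ i $ \<alpha>" for i \<alpha>
    by (rule partial_eqI) (use has_derivative_nth[OF assms, of i] in \<open>simp add: matrix_vector_mult_def\<close>)
  then show ?thesis by (simp add: jacobian_matrix_def vec_eq_iff)
qed

lemma local_parametrizationD:
  assumes "local_parametrization N U \<phi>"
  shows "open U" "\<And>i. smooth_on U (\<lambda>x. \<phi> x $ i)" "\<And>x. x \<in> U \<Longrightarrow> inj (\<lambda>a. jacobian_matrix \<phi> x *v a)"
    "openin (top_of_set N) (\<phi> ` U)" "\<phi> ` U \<subseteq> N" "continuous_on U \<phi>"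
  using assms openin_imp_subset homeomorphism_cont1
  unfolding local_parametrization_def by blast+

text \<open>
  By invariance of domain an injective continuous \<open>\<theta>\<close> is a homeomorphism onto an open set, so the
  image of \<open>W\<close> stays open in \<open>N\<close>.
\<close>
lemma local_parametrization_reparametrize:
  fixes \<theta> :: "'k::{real_normed_field,euclidean_space} ^ 'n::finite \<Rightarrow> 'k ^ 'n"
    and \<phi> :: "'k ^ 'n \<Rightarrow> 'k ^ 'm::finite"
  assumes lp: "local_parametrization N U \<phi>"
    and W: "open W" and sub: "\<theta> ` W \<subseteq> U" and inj: "inj_on \<theta> W"
    and sm: "\<And>i. smooth_on W (\<lambda>x. \<theta> x $ i)"
    and injJ: "\<And>x. x \<in> W \<Longrightarrow> inj (\<lambda>a. jacobian_matrix \<theta> x *v a)"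
  shows "local_parametrization N W (\<lambda>x. \<phi> (\<theta> x))"
    and "\<And>x. x \<in> W \<Longrightarrow> jacobian_matrix (\<lambda>x. \<phi> (\<theta> x)) x = jacobian_matrix \<phi> (\<theta> x) ** jacobian_matrix \<theta> x"
proof -
  note U = local_parametrizationD[OF lp]
  have d: "(\<theta> has_derivative (\<lambda>v. jacobian_matrix \<theta> x *v v)) (at x)" if "x \<in> W" for x
    by (rule has_derivative_jacobian[OF sm that])
  show J: "jacobian_matrix (\<lambda>x. \<phi> (\<theta> x)) x = jacobian_matrix \<phi> (\<theta> x) ** jacobian_matrix \<theta> x"
    if x: "x \<in> W" for x
  proof (rule jacobian_matrix_eqI)
    have "\<theta> x \<in> U" using sub x by auto
    from has_derivative_compose[OF d[OF x] has_derivative_jacobian[OF U(2) this]]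
    show "((\<lambda>x. \<phi> (\<theta> x)) has_derivative (\<lambda>v. (jacobian_matrix \<phi> (\<theta> x) ** jacobian_matrix \<theta> x) *v v)) (at x)"
      by (simp add: matrix_vector_mul_assoc)
  qed
  have cont: "continuous_on W \<theta>"
    using d has_derivative_continuous by (blast intro: continuous_at_imp_continuous_on)
  have op: "open (\<theta> ` W)"
    by (rule invariance_of_domain[OF cont W inj])
  obtain \<theta>' where h1: "homeomorphism W (\<theta> ` W) \<theta> \<theta>'"
    using invariance_of_domain_homeomorphism[OF W cont _ inj] by auto
  obtain \<psi> where h2: "homeomorphism U (\<phi> ` U) \<phi> \<psi>"
    using lp unfolding local_parametrization_def by blast
  have h3: "homeomorphism (\<theta> ` W) (\<phi> ` \<theta> ` W) \<phi> \<psi>"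
    by (rule homeomorphism_of_subsets[OF h2 sub]) auto
  have "openin (top_of_set U) (\<theta> ` W)"
    using op sub by (simp add: openin_open_eq U(1))
  then have "openin (top_of_set (\<phi> ` U)) (\<phi> ` \<theta> ` W)"
    by (rule homeomorphism_imp_open_map[OF h2])
  then have "openin (top_of_set N) (\<phi> ` \<theta> ` W)"
    using U(4) openin_trans by blast
  then have o: "openin (top_of_set N) ((\<lambda>x. \<phi> (\<theta> x)) ` W)"
    by (simp add: image_image)
  have h: "homeomorphism W ((\<lambda>x. \<phi> (\<theta> x)) ` W) (\<lambda>x. \<phi> (\<theta> x)) (\<theta>' \<circ> \<psi>)"
    using homeomorphism_compose[OF h1 h3] by (simp add: o_def image_image)
  have i: "inj (\<lambda>a. jacobian_matrix (\<lambda>x. \<phi> (\<theta> x)) x *v a)" if "x \<in> W" for x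
  proof -
    have "\<theta> x \<in> U" using sub that by auto
    from U(3)[OF this] injJ[OF that] show ?thesis
      unfolding J[OF that] by (auto simp: inj_def simp flip: matrix_vector_mul_assoc)
  qed
  show "local_parametrization N W (\<lambda>x. \<phi> (\<theta> x))"
    unfolding local_parametrization_def
    using W o h i smooth_on_compose[OF W sub U(2) sm] by blast
qed

lemma local_parametrization_subset:
  fixes \<phi> :: "'k::{real_normed_field,euclidean_space} ^ 'n::finite \<Rightarrow> 'k ^ 'm::finite"
  assumes "local_parametrization N U \<phi>" "open W" "W \<subseteq> U"
  shows "local_parametrization N W \<phi>"
proof -
  have "jacobian_matrix (\<lambda>x :: 'k ^ 'n. x) x = mat 1" for x
    by (rule jacobian_matrix_eqI) simp
  then show ?thesis
    using assms by (intro local_parametrization_reparametrize(1)[OF assms(1), of W "\<lambda>x. x"])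
      (auto simp: smooth_on_nth inj_def)
qed

text \<open>
  The inclusion from left to right needs an argument because a curve \<open>\<gamma>\<close> in \<open>N\<close> lifts to a curve \<open>y\<close> in \<open>U\<close>
  that is only known to be continuous. With a left inverse \<open>L\<close> of the Jacobian \<open>J\<close> the lift satisfies
  \<open>y h - x = O(h)\<close>, so \<open>\<gamma> h - \<gamma> 0 = J (y h - x) + o(h)\<close>. The operator \<open>P = J L - 1\<close> kills the range of \<open>J\<close>, hence
  \<open>P \<gamma>\<close> has derivative zero at \<open>0\<close>, which gives \<open>P v = 0\<close>, that is \<open>v = J (L v)\<close>.
\<close>
lemma tangent_space_eq_range:
  fixes \<phi> :: "'k::{real_normed_field,euclidean_space} ^ 'n::finite \<Rightarrow> 'k ^ 'm::finite"
  assumes lp: "local_parametrization N U \<phi>" and x: "x \<in> U"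
  shows "tangent_space N (\<phi> x) = range (\<lambda>a. jacobian_matrix \<phi> x *v a)"
proof -
  note U = local_parametrizationD[OF lp]
  define J where "J = jacobian_matrix \<phi> x"
  have d\<phi>: "(\<phi> has_derivative (\<lambda>v. J *v v)) (at x)"
    unfolding J_def by (rule has_derivative_jacobian[OF U(2) x])
  have scale: "((\<lambda>h. h *s w) has_derivative (\<lambda>h. h *s w)) F" for w :: "'k ^ 'b::finite" and F
    by (rule has_derivative_vecI) (auto intro!: derivative_eq_intros)
  have fd: "(\<forall>i. ((\<lambda>h. \<gamma> h $ i) has_field_derivative w $ i) F) \<longleftrightarrow> (\<gamma> has_derivative (\<lambda>h. h *s w)) F"
    for \<gamma> :: "'k \<Rightarrow> 'k ^ 'b::finite" and w F
  proof
    assume *: "\<forall>i. ((\<lambda>h. \<gamma> h $ i) has_field_derivative w $ i) F"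
    have "(*) (w $ i) = (\<lambda>h. (h *s w) $ i)" for i by (auto simp: mult.commute)
    with * show "(\<gamma> has_derivative (\<lambda>h. h *s w)) F"
      by (intro has_derivative_vecI) (simp add: has_field_derivative_def)
  next
    assume "(\<gamma> has_derivative (\<lambda>h. h *s w)) F"
    from has_derivative_nth[OF this]
    show "\<forall>i. ((\<lambda>h. \<gamma> h $ i) has_field_derivative w $ i) F"
      by (simp add: has_field_derivative_def mult.commute[of _ "w $ _"])
  qed
  show ?thesis unfolding J_def[symmetric]
  proof (intro equalityI subsetI)
    fix v assume "v \<in> range (\<lambda>a. J *v a)"
    then obtain a where v: "v = J *v a" by blast
    define \<gamma> where "\<gamma> = (\<lambda>h. \<phi> (x + h *s a))"
    have l: "((\<lambda>h. x + h *s a) has_derivative (\<lambda>h. h *s a)) (at 0)"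
      using has_derivative_add[OF has_derivative_const scale] by simp
    have "isCont (\<lambda>h. x + h *s a) 0" by (rule has_derivative_continuous[OF l])
    then have "((\<lambda>h. x + h *s a) \<longlongrightarrow> x + 0 *s a) (nhds 0)"
      unfolding isCont_def tendsto_at_iff_tendsto_nhds[of "\<lambda>h. x + h *s a"] .
    then have "\<forall>\<^sub>F h in nhds 0. x + h *s a \<in> U"
      by (rule topological_tendstoD) (use U(1) x in auto)
    then have ev: "\<forall>\<^sub>F h in nhds 0. \<gamma> h \<in> N"
      by (rule eventually_mono) (use U(5) in \<open>auto simp: \<gamma>_def\<close>)
    have "(\<gamma> has_derivative (\<lambda>h. J *v (h *s a))) (at 0)"
      unfolding \<gamma>_def using has_derivative_compose[OF l, of \<phi> "\<lambda>v. J *v v"] d\<phi> by simp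
    then have "\<forall>i. ((\<lambda>h. \<gamma> h $ i) has_field_derivative v $ i) (at 0)"
      unfolding fd by (simp add: vector_scalar_commute v)
    with ev show "v \<in> tangent_space N (\<phi> x)"
      unfolding tangent_space_def by (auto intro!: exI[of _ \<gamma>] simp: \<gamma>_def)
  next
    fix v assume "v \<in> tangent_space N (\<phi> x)"
    then obtain \<gamma> where \<gamma>: "\<gamma> 0 = \<phi> x" "\<forall>\<^sub>F h in nhds 0. \<gamma> h \<in> N"
      and "\<forall>i. ((\<lambda>h. \<gamma> h $ i) has_field_derivative v $ i) (at 0)"
      unfolding tangent_space_def by blast
    then have d\<gamma>: "(\<gamma> has_derivative (\<lambda>h. h *s v)) (at 0)" unfolding fd by blast
    obtain \<psi> where \<psi>: "homeomorphism U (\<phi> ` U) \<phi> \<psi>"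
      using lp unfolding local_parametrization_def by blast
    obtain T where T: "open T" "\<phi> ` U = N \<inter> T"
      using U(4) unfolding openin_open by blast
    have g0: "(\<gamma> \<longlongrightarrow> \<phi> x) (nhds 0)"
      using has_derivative_continuous[OF d\<gamma>, unfolded isCont_def tendsto_at_iff_tendsto_nhds] \<gamma>(1) by simp
    have "\<forall>\<^sub>F h in nhds 0. \<gamma> h \<in> T"
      by (rule topological_tendstoD[OF g0 T(1)]) (use T(2) x in auto)
    with \<gamma>(2) have evU: "\<forall>\<^sub>F h in nhds 0. \<gamma> h \<in> \<phi> ` U"
      by eventually_elim (simp add: T(2))
    define y where "y = (\<lambda>h. \<psi> (\<gamma> h))"
    have y0: "(y \<longlongrightarrow> x) (nhds 0)"
    proof -
      have "continuous_on (\<phi> ` U) \<psi>" using \<psi> homeomorphism_cont2 by blast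
      from continuous_on_tendsto_compose[OF this g0 _ evU]
      show ?thesis using x by (simp add: y_def homeomorphism_apply1[OF \<psi>])
    qed
    have ev: "\<forall>\<^sub>F h in nhds 0. \<phi> (y h) = \<gamma> h"
      using evU by eventually_elim (simp add: y_def homeomorphism_apply2[OF \<psi>])
    obtain L where L: "L ** J = mat 1"
      using iffD2[OF matrix_left_invertible_injective U(3)[OF x]] unfolding J_def by blast
    define P where "P = J ** L - mat 1"
    have PJ: "P *v (J *v w) = 0" and LJ: "L *v (J *v w) = w" for w
    proof -
      show LJ: "L *v (J *v w) = w" for w
        by (simp add: L matrix_vector_mul_assoc)
      show "P *v (J *v w) = 0"
        by (simp add: P_def matrix_vector_mult_diff_rdistrib LJ flip: matrix_vector_mul_assoc)
    qed
    obtain BL where BL: "BL > 0" "\<And>w. norm (L *v w) \<le> norm w * BL"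
      using bounded_linear.pos_bounded[OF matrix_vector_mul_bounded_linear[of L]] by blast
    obtain BP where BP: "BP > 0" "\<And>w. norm (P *v w) \<le> norm w * BP"
      using bounded_linear.pos_bounded[OF matrix_vector_mul_bounded_linear[of P]] by blast
    obtain B where B: "B > 0" "\<And>h. norm (h *s v) \<le> norm h * B"
      using bounded_linear.pos_bounded[OF has_derivative_bounded_linear[OF d\<gamma>]] by blast
    have "\<forall>e>0. \<exists>d>0. \<forall>h. norm (h - 0) < d \<longrightarrow> norm (\<gamma> h - \<gamma> 0 - (h - 0) *s v) \<le> e * norm (h - 0)"
      using d\<gamma> unfolding has_derivative_at_alt by blast
    then obtain d1 where d1: "d1 > 0" "\<And>h. norm h < d1 \<Longrightarrow> norm (\<gamma> h - \<phi> x - h *s v) \<le> norm h"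
      unfolding \<gamma>(1) by (metis diff_zero mult_1 zero_less_one)
    define C where "C = 1 + B"
    have C: "norm (\<gamma> h - \<phi> x) \<le> C * norm h" if "norm h < d1" for h
      using norm_triangle_ineq[of "\<gamma> h - \<phi> x - h *s v" "h *s v"] d1(2)[OF that] B(2)[of h]
      by (simp add: C_def distrib_right mult.commute[of _ B])
    have "C > 0" using B by (simp add: C_def)
    have "((\<lambda>h. P *v \<gamma> h) has_derivative (\<lambda>h. 0)) (at 0)"
      unfolding has_derivative_at_alt
    proof (intro conjI allI impI bounded_linear_zero)
      fix e :: real assume "e > 0"
      \<comment> \<open>The first bound lets the error \<open>r\<close> be absorbed into \<open>norm d\<close>; the second one turns the
        resulting estimate \<open>norm d \<le> 2 * BL * C * norm h\<close> into the required one for \<open>P *v r\<close>.\<close>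
      define \<epsilon> where "\<epsilon> = min (1 / (2 * BL)) (e / (2 * BP * BL * C))"
      have \<epsilon>: "\<epsilon> > 0" "BL * \<epsilon> \<le> 1 / 2" "\<epsilon> * (2 * BP * BL * C) \<le> e"
        using \<open>e > 0\<close> BL(1) BP(1) \<open>C > 0\<close> by (auto simp: \<epsilon>_def min_def field_simps)
      obtain \<delta> where \<delta>: "\<delta> > 0" "\<And>z. norm (z - x) < \<delta> \<Longrightarrow> norm (\<phi> z - \<phi> x - J *v (z - x)) \<le> \<epsilon> * norm (z - x)"
        using d\<phi> \<epsilon>(1) unfolding has_derivative_at_alt by blast
      have "\<forall>\<^sub>F h in nhds 0. norm (y h - x) < \<delta>"
        using tendstoD[OF y0 \<delta>(1)] by (simp add: dist_norm)
      with ev have "\<forall>\<^sub>F h in nhds 0. \<phi> (y h) = \<gamma> h \<and> norm (y h - x) < \<delta>" by eventually_elim simp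
      then obtain d2 where d2: "d2 > 0" "\<And>h. norm h < d2 \<Longrightarrow> \<phi> (y h) = \<gamma> h \<and> norm (y h - x) < \<delta>"
        unfolding eventually_nhds_metric by (auto simp: dist_norm)
      show "\<exists>d>0. \<forall>h. norm (h - 0) < d \<longrightarrow> norm (P *v \<gamma> h - P *v \<gamma> 0 - 0) \<le> e * norm (h - 0)"
      proof (intro exI[of _ "min d1 d2"] conjI allI impI)
        show "min d1 d2 > 0" using d1 d2 by simp
        fix h :: 'k assume "norm (h - 0) < min d1 d2"
        then have h: "norm h < d1" "norm h < d2" by auto
        define d where "d = y h - x"
        define r where "r = \<gamma> h - \<phi> x - J *v d"
        have r: "norm r \<le> \<epsilon> * norm d"
          unfolding r_def d_def using \<delta>(2)[of "y h"] d2(2)[OF h(2)] by simp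
        have "d = L *v (J *v d)" by (simp add: LJ)
        also have "J *v d = (\<gamma> h - \<phi> x) - r" by (simp add: r_def)
        also have "norm (L *v ((\<gamma> h - \<phi> x) - r)) \<le> norm (\<gamma> h - \<phi> x - r) * BL" by (rule BL(2))
        also have "\<dots> \<le> (norm (\<gamma> h - \<phi> x) + norm r) * BL"
          using BL(1) by (intro mult_right_mono norm_triangle_ineq4) auto
        also have "\<dots> \<le> (C * norm h + \<epsilon> * norm d) * BL"
          using BL(1) C[OF h(1)] r by (intro mult_right_mono add_mono) auto
        also have "\<dots> = C * norm h * BL + (BL * \<epsilon>) * norm d" by (simp add: algebra_simps)
        also have "\<dots> \<le> C * norm h * BL + (1 / 2) * norm d"
          using \<epsilon>(2) by (intro add_left_mono mult_right_mono) auto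
        finally have d: "norm d \<le> 2 * (C * norm h * BL)" by simp
        have "P *v \<gamma> h - P *v \<gamma> 0 - 0 = P *v (J *v d + r)"
          by (simp add: r_def \<gamma>(1) matrix_vector_mult_diff_distrib)
        also have "\<dots> = P *v r" by (simp add: matrix_vector_right_distrib PJ)
        also have "norm \<dots> \<le> norm r * BP" by (rule BP(2))
        also have "\<dots> \<le> (\<epsilon> * (2 * (C * norm h * BL))) * BP"
          using r d \<epsilon>(1) BP(1) by (intro mult_right_mono order.trans[OF r] mult_left_mono) auto
        also have "\<dots> = (\<epsilon> * (2 * BP * BL * C)) * norm h" by (simp add: algebra_simps)
        also have "\<dots> \<le> e * norm h" using \<epsilon>(3) by (intro mult_right_mono) auto
        finally show "norm (P *v \<gamma> h - P *v \<gamma> 0 - 0) \<le> e * norm (h - 0)" by simp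
      qed
    qed
    moreover have "((\<lambda>h. P *v \<gamma> h) has_derivative (\<lambda>h. P *v (h *s v))) (at 0)"
      by (rule bounded_linear.has_derivative[OF matrix_vector_mul_bounded_linear d\<gamma>])
    ultimately have "(\<lambda>h. 0) = (\<lambda>h. P *v (h *s v))"
      by (rule has_derivative_unique)
    from fun_cong[OF this, of 1] have "P *v v = 0" by simp
    then have "v = J *v (L *v v)"
      by (simp add: P_def matrix_vector_mult_diff_rdistrib matrix_vector_mul_assoc)
    then show "v \<in> range (\<lambda>a. J *v a)" by blast
  qed
qed

section \<open>Primitives\<close>

text \<open>
  The primitive is \<open>\<integral> H(a + s (z - a)) (z - a) ds\<close> over \<open>0 \<le> s \<le> 1\<close>. Its integrand differentiated with respect to \<open>z\<close>
  is the derivative of \<open>s H(a + s (z - a))\<close> with respect to \<open>s\<close>, so the integral of it is \<open>H z\<close>. The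
  formula serves real and complex scalars alike.
\<close>
lemma has_primitive_on_convex:
  fixes H H' :: "'k::{real_normed_field,banach} \<Rightarrow> 'k"
  assumes B: "open B" "convex B" "a \<in> B"
    and H: "\<And>z. z \<in> B \<Longrightarrow> (H has_field_derivative H' z) (at z)"
    and cont: "continuous_on B H'"
  obtains P where "P a = 0" "\<And>z. z \<in> B \<Longrightarrow> (P has_field_derivative H z) (at z)"
proof -
  define P where "P = (\<lambda>z. integral (cbox 0 (1::real)) (\<lambda>s. H (a + of_real s * (z - a)) * (z - a)))"
  define f' where "f' = (\<lambda>z (s::real). H' (a + of_real s * (z - a)) * of_real s * (z - a) + H (a + of_real s * (z - a)))"
  have inB: "a + of_real s * (z - a) \<in> B" if "z \<in> B" "s \<in> cbox 0 (1::real)" for z s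
  proof -
    have "(1 - s) *\<^sub>R a + s *\<^sub>R z \<in> B"
      using convexD_alt[OF B(2,3) that(1)] that(2) by simp
    then show ?thesis by (simp add: scaleR_conv_of_real algebra_simps)
  qed
  have contH: "continuous_on B H"
    using H by (meson DERIV_isCont continuous_at_imp_continuous_on)
  have P': "(P has_field_derivative H z) (at z)" if z: "z \<in> B" for z
  proof -
    have "(P has_field_derivative integral (cbox 0 1) (f' z)) (at z within B)"
      unfolding P_def
    proof (rule leibniz_rule_field_derivative[OF _ _ _ z B(2)])
      fix w s assume ws: "w \<in> B" "s \<in> cbox 0 (1::real)"
      have "((\<lambda>x. H (a + of_real s * (x - a))) has_field_derivative H' (a + of_real s * (w - a)) * of_real s) (at w)"
        by (rule DERIV_chain2[where f = H and g = "\<lambda>x. a + of_real s * (x - a)", OF H]) (auto intro: inB[OF ws] intro!: derivative_eq_intros)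
      moreover have "((\<lambda>x. x - a) has_field_derivative 1) (at w)"
        by (auto intro!: derivative_eq_intros)
      ultimately have "((\<lambda>x. H (a + of_real s * (x - a)) * (x - a)) has_field_derivative f' w s) (at w)"
        unfolding f'_def by (rule DERIV_mult[THEN DERIV_cong]) simp
      then show "((\<lambda>x. H (a + of_real s * (x - a)) * (x - a)) has_field_derivative f' w s) (at w within B)"
        by (rule has_field_derivative_at_within)
    next
      fix w assume w: "w \<in> B"
      have "continuous_on (cbox 0 1) (\<lambda>s::real. H (a + of_real s * (w - a)))"
        by (rule continuous_on_compose2[OF contH]) (auto intro!: continuous_intros inB[OF w])
      then show "(\<lambda>s. H (a + of_real s * (w - a)) * (w - a)) integrable_on cbox 0 (1::real)"
        by (intro integrable_continuous continuous_intros)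
    next
      have "continuous_on (B \<times> cbox 0 1) (\<lambda>p. H (a + of_real (snd p :: real) * (fst p - a)))"
        by (rule continuous_on_compose2[OF contH]) (auto intro!: continuous_intros inB)
      moreover have "continuous_on (B \<times> cbox 0 1) (\<lambda>p. H' (a + of_real (snd p :: real) * (fst p - a)))"
        by (rule continuous_on_compose2[OF cont]) (auto intro!: continuous_intros inB)
      ultimately show "continuous_on (B \<times> cbox 0 1) (\<lambda>(x, s). f' x s)"
        unfolding f'_def case_prod_unfold by (intro continuous_intros)
    qed
    moreover have "(f' z has_integral (of_real 1 * H (a + of_real 1 * (z - a)) - of_real 0 * H (a + of_real 0 * (z - a)))) {0..1}"
    proof (rule fundamental_theorem_of_calculus)
      fix s :: real assume "s \<in> {0..1}"
      then have s: "s \<in> cbox 0 1" by simp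
      have "((\<lambda>x. H (a + x * (z - a))) has_field_derivative H' (a + of_real s * (z - a)) * (z - a)) (at (of_real s))"
        by (rule DERIV_chain2[where f = H and g = "\<lambda>x. a + x * (z - a)", OF H]) (auto intro: inB[OF z s] intro!: derivative_eq_intros)
      from DERIV_mult[OF DERIV_ident this]
      have "((\<lambda>x. x * H (a + x * (z - a))) has_field_derivative f' z s) (at (of_real s))"
        unfolding f'_def by (rule DERIV_cong) (simp add: mult_ac)
      then show "((\<lambda>s. of_real s * H (a + of_real s * (z - a))) has_vector_derivative f' z s) (at s within {0..1})"
        by (rule has_vector_derivative_real_field)
    qed simp
    then have "integral (cbox 0 1) (f' z) = H z"
      by (simp add: integral_unique)
    ultimately show ?thesis
      using at_within_open[OF z B(1)] by simp
  qed
  show thesis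
  proof (rule that[of P])
    show "P a = 0" by (simp add: P_def)
  qed (rule P')
qed

text \<open>
  On a ball, \<open>h\<close> is constant along the intersections with lines in the first direction and every such
  line meeting the ball passes, within the ball, through a point whose first coordinate is that of the centre. So
  \<open>h\<close> is a function \<open>H\<close> of the second coordinate, which has a primitive in one variable. Normalizing \<open>P\<close> at
  the centre lets the shear of the plane by \<open>P\<close> fix the centre.
\<close>
lemma primitive_in_second_coordinate:
  fixes h :: "'k::{real_normed_field,euclidean_space} ^ 2 \<Rightarrow> 'k"
  assumes r: "r > 0" and sm: "smooth_on (ball x0 r) h"
    and h1: "\<And>x. x \<in> ball x0 r \<Longrightarrow> partial 1 h x = 0"
  obtains P where "P (x0 $ 2) = 0" "smooth_on (ball x0 r) (\<lambda>x. P (x $ 2))"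
    "\<And>x. x \<in> ball x0 r \<Longrightarrow> (P has_field_derivative h x) (at (x $ 2))"
    "\<And>x. x \<in> ball x0 r \<Longrightarrow> ((\<lambda>x. P (x $ 2)) has_derivative (\<lambda>v. h x * v $ 2)) (at x)"
proof -
  define base where "base = x0 - axis 2 (x0 $ 2)"
  define B where "B = ball (x0 $ 2) r"
  have ptd: "base + axis 2 z - x0 = axis 2 (z - x0 $ 2)" for z
    by (simp add: base_def vec_eq_iff axis_def)
  have pt: "base + axis 2 z \<in> ball x0 r \<longleftrightarrow> z \<in> B" for z
    using ptd[of z] by (simp add: B_def dist_norm norm_minus_commute[of _ "_ + _"] norm_axis norm_minus_commute[of _ z])
  have x2B: "x $ 2 \<in> B" if "x \<in> ball x0 r" for x
    using that Finite_Cartesian_Product.norm_nth_le[of "x - x0" 2]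
    by (simp add: B_def dist_norm norm_minus_commute)
  define H where "H = (\<lambda>z. h (base + axis 2 z))"
  define H' where "H' = (\<lambda>z. partial 2 h (base + axis 2 z))"
  have dH: "(H has_field_derivative H' z) (at z)" if "z \<in> B" for z
    unfolding H_def H'_def
    by (rule DERIV_along_axis[of _ "\<lambda>i. partial i h (base + axis 2 z)"]) (rule smooth_onD[OF sm], simp only: pt that)
  have "continuous_on (ball x0 r) (partial 2 h)"
    using smooth_on_partial[OF sm, of 2] unfolding smooth_on_def by (metis Ck_on.simps(1))
  then have cH': "continuous_on B H'"
    unfolding H'_def
    by (rule continuous_on_compose2)
       (auto intro!: continuous_intros bounded_linear.continuous_on[OF bounded_linear_axis] simp only: pt image_subset_iff)
  have Hh: "H (x $ 2) = h x" if x: "x \<in> ball x0 r" for x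
  proof -
    define b where "b = x - axis 1 (x $ 1)"
    define A where "A = {s. b + axis 1 s \<in> ball x0 r}"
    have "convex A"
      unfolding convex_alt
    proof (intro ballI allI impI)
      fix s t :: 'k and w :: real assume st: "s \<in> A" "t \<in> A" and w: "0 \<le> w \<and> w \<le> 1"
      have "(1 - w) *\<^sub>R (b + axis 1 s) + w *\<^sub>R (b + axis 1 t) \<in> ball x0 r"
        using st w by (intro convexD_alt convex_ball) (auto simp: A_def)
      moreover have "(1 - w) *\<^sub>R (b + axis 1 s) + w *\<^sub>R (b + axis 1 t) = b + axis 1 ((1 - w) *\<^sub>R s + w *\<^sub>R t)"
        by (simp add: vec_eq_iff axis_def algebra_simps)
      ultimately show "(1 - w) *\<^sub>R s + w *\<^sub>R t \<in> A" by (simp add: A_def)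
    qed
    moreover have "((\<lambda>s. h (b + axis 1 s)) has_field_derivative 0) (at s within A)" if "s \<in> A" for s
    proof -
      have "b + axis 1 s \<in> ball x0 r" using that by (simp add: A_def)
      from DERIV_along_axis[OF smooth_onD[OF sm this]] h1[OF this]
      show ?thesis by (simp add: has_field_derivative_at_within)
    qed
    ultimately obtain c where c: "\<And>s. s \<in> A \<Longrightarrow> h (b + axis 1 s) = c"
      using has_field_derivative_zero_constant[of A "\<lambda>s. h (b + axis 1 s)"] by blast
    have 1: "b + axis 1 (x $ 1) = x" by (simp add: b_def)
    have 2: "b + axis 1 (x0 $ 1) = base + axis 2 (x $ 2)"
      by (simp add: b_def base_def vec_eq_iff forall_2 axis_def)
    have "x $ 1 \<in> A" "x0 $ 1 \<in> A"
      unfolding A_def mem_Collect_eq 1 2 pt using x x2B by auto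
    from c[OF this(1)] c[OF this(2)] show ?thesis
      by (simp only: H_def 1 2)
  qed
  have "x0 $ 2 \<in> B" "open B" "convex B" using r by (simp_all add: B_def)
  then obtain P where P: "P (x0 $ 2) = 0" "\<And>z. z \<in> B \<Longrightarrow> (P has_field_derivative H z) (at z)"
    using has_primitive_on_convex[OF _ _ _ dH cH', of "x0 $ 2"] by blast
  have P': "(P has_field_derivative h x) (at (x $ 2))" if "x \<in> ball x0 r" for x
    using P(2)[OF x2B[OF that]] by (simp add: Hh[OF that])
  have dP: "((\<lambda>x. P (x $ 2)) has_derivative (\<lambda>v. h x * v $ 2)) (at x)" if x: "x \<in> ball x0 r" for x
  proof -
    have "(P has_derivative (\<lambda>z. h x * z)) (at (x $ 2))"
      using P'[OF x] by (simp add: has_field_derivative_def)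
    from has_derivative_compose[OF bounded_linear_imp_has_derivative[OF bounded_linear_vec_nth] this]
    show ?thesis .
  qed
  have "smooth_on (ball x0 r) (\<lambda>x. P (x $ 2))"
  proof (rule smooth_onI[of _ _ "\<lambda>i x. if i = 2 then h x else 0"])
    fix x assume "x \<in> ball x0 r"
    from dP[OF this] show "((\<lambda>x. P (x $ 2)) has_derivative (\<lambda>v. \<Sum>i\<in>UNIV. (if i = 2 then h x else 0) * v $ i)) (at x)"
      by (simp add: sum_2)
  next
    fix i :: 2
    show "smooth_on (ball x0 r) (\<lambda>x. if i = 2 then h x else 0)"
      using sm by (cases "i = 2") (simp_all add: smooth_on_const)
  qed simp
  from that[OF P(1) this P' dP] show thesis .
qed

section \<open>The smooth inverse function theorem\<close>

lemma Ck_on_prod: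
  fixes f :: "'b \<Rightarrow> 'k::real_normed_field ^ 'a::finite \<Rightarrow> 'k"
  assumes "open S" "\<And>i. i \<in> I \<Longrightarrow> Ck_on n S (f i)"
  shows "Ck_on n S (\<lambda>x. \<Prod>i\<in>I. f i x)"
  using assms(2)
proof (induction I rule: infinite_finite_induct)
  case (insert i I)
  have "Ck_on n S (\<lambda>x. f i x * (\<Prod>i\<in>I. f i x))"
    using insert by (intro Ck_on_mult[OF assms(1)]) simp_all
  then show ?case using insert.hyps by simp
qed (simp_all add: Ck_on_const[OF assms(1)])

lemma Ck_on_det:
  fixes A :: "'k::real_normed_field ^ 'a::finite \<Rightarrow> 'k ^ 'n::finite ^ 'n"
  assumes "open S" "\<And>i j. Ck_on n S (\<lambda>x. A x $ i $ j)"
  shows "Ck_on n S (\<lambda>x. det (A x))"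
  unfolding det_def
  by (intro Ck_on_sum Ck_on_mult Ck_on_prod Ck_on_const assms)

lemma matrix_inv_cancel:
  fixes A :: "'a::field ^ 'n ^ 'n"
  assumes "invertible A"
  shows "A ** matrix_inv A = mat 1" "matrix_inv A ** A = mat 1"
  using someI_ex[OF assms[unfolded invertible_def]] unfolding matrix_inv_def by simp_all

text \<open>
  Cramer's rule makes the entries of the inverse matrix rational functions of the entries of the
  matrix, which is what carries differentiability over from a matrix to its inverse.
\<close>
lemma matrix_inv_nth_cramer:
  fixes A :: "'a::field ^ 'n ^ 'n"
  assumes "det A \<noteq> 0"
  shows "matrix_inv A $ k $ i = det (\<chi> a b. if b = k then axis i 1 $ a else A $ a $ b) / det A"
proof -
  have "invertible A" using assms by (simp add: invertible_det_nz)
  then have "A *v (matrix_inv A *v axis i 1) = axis i 1"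
    by (simp add: matrix_vector_mul_assoc matrix_inv_cancel)
  then have "matrix_inv A *v axis i 1 = (\<chi> k. det (\<chi> a b. if b = k then axis i 1 $ a else A $ a $ b) / det A)"
    using cramer[OF assms] by blast
  then have "(matrix_inv A *v axis i 1) $ k = det (\<chi> a b. if b = k then axis i 1 $ a else A $ a $ b) / det A"
    by simp
  then show ?thesis
    by (simp add: matrix_vector_mult_def sum_mult_axis)
qed

text \<open>
  The inverse function theorem for class \<open>C\<^sup>1\<close> provides a differentiable local inverse \<open>g\<close> with Jacobian \<open>J(g y)\<inverse>\<close>. If \<open>g\<close> is of
  class \<open>C\<^sup>n\<close>, so is \<open>J \<circ> g\<close> and by Cramer's rule its inverse; thus \<open>g\<close> is of class \<open>C\<^sup>n\<^sup>+\<^sup>1\<close>, and induction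
  gives smoothness.
\<close>
lemma smooth_inverse_function_theorem:
  fixes f :: "'k::{real_normed_field,euclidean_space} ^ 'n::finite \<Rightarrow> 'k ^ 'n"
  assumes U: "open U" "x0 \<in> U"
    and sm: "\<And>i. smooth_on U (\<lambda>x. f x $ i)"
    and det: "det (jacobian_matrix f x0) \<noteq> 0"
  obtains U' V g where "open U'" "U' \<subseteq> U" "x0 \<in> U'" "open V" "f x0 \<in> V" "homeomorphism U' V f g"
    "\<And>i. smooth_on V (\<lambda>y. g y $ i)" "\<And>y. y \<in> V \<Longrightarrow> inj (\<lambda>a. jacobian_matrix g y *v a)"
proof -
  define J where "J = jacobian_matrix f"
  define f' where "f' = (\<lambda>x. Blinfun (\<lambda>v. J x *v v))"
  have f': "blinfun_apply (f' x) = (\<lambda>v. J x *v v)" for x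
    unfolding f'_def by (rule bounded_linear_Blinfun_apply) simp
  have der: "(f has_derivative blinfun_apply (f' x)) (at x)" if "x \<in> U" for x
    unfolding f' J_def by (rule has_derivative_jacobian[OF sm that])
  have smJ: "smooth_on U (\<lambda>x. J x $ i $ j)" for i j
    unfolding J_def jacobian_matrix_def using smooth_on_partial[OF sm] by simp
  then have contJ: "continuous_on U (\<lambda>x. J x $ i $ j)" for i j
    unfolding smooth_on_def by (metis Ck_on.simps(1))
  have "continuous_on U (\<lambda>x. blinfun_apply (f' x) v)" for v
    unfolding f' matrix_vector_mult_def
    by (intro continuous_intros continuous_on_vec_lambda contJ)
  then have cont: "continuous_on U f'"
    by (rule continuous_on_blinfun_componentwise)
  define A where "A = Blinfun (\<lambda>v. matrix_inv (J x0) *v v)"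
  have A: "blinfun_apply A = (\<lambda>v. matrix_inv (J x0) *v v)"
    unfolding A_def by (rule bounded_linear_Blinfun_apply) simp
  have "invertible (J x0)" using det by (simp add: invertible_det_nz J_def)
  then have invf: "A o\<^sub>L f' x0 = id_blinfun"
    by (intro blinfun_eqI) (simp add: A f' matrix_vector_mul_assoc matrix_inv_cancel)
  obtain U' V g g' where *: "open U'" "U' \<subseteq> U" "x0 \<in> U'" "open V" "f x0 \<in> V" "homeomorphism U' V f g"
    and g: "\<And>y. y \<in> V \<Longrightarrow> (g has_derivative (g' y)) (at y)"
    and g': "\<And>y. y \<in> V \<Longrightarrow> g' y = inv (blinfun_apply (f' (g y)))"
    and bij: "\<And>y. y \<in> V \<Longrightarrow> bij (blinfun_apply (f' (g y)))"
    proof (rule inverse_function_theorem[OF U(1) der cont U(2) invf], goal_cases)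
    case (2 U' V g g')
    show ?case by (rule 2(1)) (fact 2)+
  qed
  have gV: "g ` V \<subseteq> U"
    using *(2,6) by (auto simp: homeomorphism_def)
  have inv: "invertible (J (g y))" if "y \<in> V" for y
    using bij[OF that] iffD2[OF matrix_left_invertible_injective, of "J (g y)"]
    unfolding f' bij_def invertible_left_inverse by blast
  have dg: "(g has_derivative (\<lambda>v. matrix_inv (J (g y)) *v v)) (at y)" if "y \<in> V" for y
  proof -
    have "g' y = (\<lambda>v. matrix_inv (J (g y)) *v v)"
      unfolding g'[OF that] f'
      by (rule inv_unique_comp) (auto simp: matrix_vector_mul_assoc matrix_inv_cancel inv[OF that])
    then show ?thesis using g[OF that] by simp
  qed
  have Jg: "jacobian_matrix g y = matrix_inv (J (g y))" if "y \<in> V" for y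
    by (rule jacobian_matrix_eqI[OF dg[OF that]])
  have "Ck_on n V (\<lambda>y. g y $ k)" for n k
  proof (induction n arbitrary: k)
    case 0
    have "continuous_on V g"
      using *(6) by (simp add: homeomorphism_def)
    then show ?case by (simp add: bounded_linear.continuous_on[OF bounded_linear_vec_nth])
  next
    case (Suc n)
    show ?case
    proof (rule Ck_on_SucI[OF *(4), of _ "\<lambda>i y. matrix_inv (J (g y)) $ k $ i"])
      fix y assume "y \<in> V"
      from has_derivative_nth[OF dg[OF this], of k]
      show "((\<lambda>y. g y $ k) has_derivative (\<lambda>v. \<Sum>i\<in>UNIV. matrix_inv (J (g y)) $ k $ i * v $ i)) (at y)"
        by (simp add: matrix_vector_mult_def)
    next
      fix i
      have CJ: "Ck_on n V (\<lambda>y. J (g y) $ a $ b)" for a b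
        using Ck_on_compose[OF *(4) gV _ Suc] smJ[of a b] unfolding smooth_on_def by blast
      have "Ck_on n V (\<lambda>y. (\<chi> a b. if b = k then axis i 1 $ a else J (g y) $ a $ b) $ a $ b)" for a b
        by (cases "b = k") (simp_all add: CJ Ck_on_const[OF *(4)])
      then have 1: "Ck_on n V (\<lambda>y. det (\<chi> a b. if b = k then axis i 1 $ a else J (g y) $ a $ b))"
        by (rule Ck_on_det[OF *(4)])
      have 2: "Ck_on n V (\<lambda>y. inverse (det (J (g y))))"
        by (rule Ck_on_inverse[OF *(4) _ Ck_on_det[OF *(4) CJ]]) (use inv in \<open>simp add: invertible_det_nz\<close>)
      show "Ck_on n V (\<lambda>y. matrix_inv (J (g y)) $ k $ i)"
        by (rule Ck_on_cong[OF *(4) Ck_on_mult[OF *(4) 1 2]])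
           (use inv in \<open>simp add: invertible_det_nz matrix_inv_nth_cramer divide_inverse\<close>)
    qed
  qed
  then have smg: "smooth_on V (\<lambda>y. g y $ k)" for k by (simp add: smooth_on_def)
  have "inj (\<lambda>a. jacobian_matrix g y *v a)" if y: "y \<in> V" for y
  proof -
    have "\<exists>B. B ** jacobian_matrix g y = mat 1"
      unfolding Jg[OF y] using matrix_inv_cancel(1)[OF inv[OF y]] by blast
    then show ?thesis by (simp add: matrix_left_invertible_injective)
  qed
  from that[OF * smg this] show thesis .
qed

section \<open>Functions that are constant in one coordinate\<close>

lemma partial_add:
  assumes "smooth_on S f" "smooth_on S g" "x \<in> S"
  shows "partial i (\<lambda>x. f x + g x) x = partial i f x + partial i g x"
proof (rule partial_eqI[where a = "\<lambda>i. partial i f x + partial i g x"])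
  show "((\<lambda>x. f x + g x) has_derivative (\<lambda>v. \<Sum>i\<in>UNIV. (partial i f x + partial i g x) * v $ i)) (at x)"
    using has_derivative_add[OF smooth_onD[OF assms(1,3)] smooth_onD[OF assms(2,3)]]
    by (simp add: distrib_right sum.distrib)
qed

lemma partial_mult:
  assumes "smooth_on S f" "smooth_on S g" "x \<in> S"
  shows "partial i (\<lambda>x. f x * g x) x = f x * partial i g x + partial i f x * g x"
proof (rule partial_eqI[where a = "\<lambda>i. f x * partial i g x + partial i f x * g x"])
  show "((\<lambda>x. f x * g x) has_derivative (\<lambda>v. \<Sum>i\<in>UNIV. (f x * partial i g x + partial i f x * g x) * v $ i)) (at x)"
    using has_derivative_mult[OF smooth_onD[OF assms(1,3)] smooth_onD[OF assms(2,3)]]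
    by (simp add: sum.distrib algebra_simps sum_distrib_left sum_distrib_right)
qed

text \<open>
  A vanishing value of \<open>partial\<close> carries information only for differentiable functions, so smoothness is part
  of the notion.
\<close>
definition constant_along_on :: "'n \<Rightarrow> ('k::real_normed_field ^ 'n::finite) set \<Rightarrow> ('k ^ 'n \<Rightarrow> 'k) \<Rightarrow> bool" where
  "constant_along_on \<alpha> S f \<longleftrightarrow> smooth_on S f \<and> (\<forall>x\<in>S. partial \<alpha> f x = 0)"

lemma constant_along_on_const: "open S \<Longrightarrow> constant_along_on \<alpha> S (\<lambda>x. c)"
  by (simp add: constant_along_on_def smooth_on_const partial_const_on)

lemma constant_along_on_add:
  "open S \<Longrightarrow> constant_along_on \<alpha> S f \<Longrightarrow> constant_along_on \<alpha> S g \<Longrightarrow> constant_along_on \<alpha> S (\<lambda>x. f x + g x)"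
  by (simp add: constant_along_on_def smooth_on_add partial_add[of S])

lemma constant_along_on_mult:
  "open S \<Longrightarrow> constant_along_on \<alpha> S f \<Longrightarrow> constant_along_on \<alpha> S g \<Longrightarrow> constant_along_on \<alpha> S (\<lambda>x. f x * g x)"
  by (simp add: constant_along_on_def smooth_on_mult partial_mult[of S])

lemma constant_along_on_sum:
  assumes "open S" "\<And>i. i \<in> I \<Longrightarrow> constant_along_on \<alpha> S (f i)"
  shows "constant_along_on \<alpha> S (\<lambda>x. \<Sum>i\<in>I. f i x)"
  using assms(2)
proof (induction I rule: infinite_finite_induct)
  case (insert i I)
  have "constant_along_on \<alpha> S (\<lambda>x. f i x + (\<Sum>i\<in>I. f i x))"
    using insert by (intro constant_along_on_add[OF assms(1)]) simp_all
  then show ?case using insert.hyps by simp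
qed (simp_all add: constant_along_on_const[OF assms(1)])

section \<open>The cubic form of a prepotential\<close>

lemma matrix_inv_eqI:
  fixes A :: "'a::field ^ 'n ^ 'n"
  assumes "A ** B = mat 1"
  shows "matrix_inv A = B"
proof -
  have "invertible A"
    using assms matrix_left_right_inverse[of A B] unfolding invertible_def by blast
  then have "matrix_inv A ** (A ** B) = B"
    by (simp add: matrix_mul_assoc matrix_inv_cancel)
  then show ?thesis by (simp add: assms)
qed

text \<open>
  The form \<open>\<eta>(a \<circ> b, d)\<close>, see \<open>eta_form_mult\<close>.
\<close>
definition c_form :: "('k::real_normed_field ^ 'm::finite \<Rightarrow> 'k) \<Rightarrow> 'k ^ 'm \<Rightarrow> 'k ^ 'm \<Rightarrow> 'k ^ 'm \<Rightarrow> 'k ^ 'm \<Rightarrow> 'k" where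
  "c_form F t a b d = (\<Sum>i\<in>UNIV. \<Sum>j\<in>UNIV. \<Sum>k\<in>UNIV. third_deriv F t i j k * a $ i * b $ j * d $ k)"

lemma c_form_linear:
  "c_form F t (a + a') b d = c_form F t a b d + c_form F t a' b d"
  "c_form F t a (b + b') d = c_form F t a b d + c_form F t a b' d"
  "c_form F t a b (d + d') = c_form F t a b d + c_form F t a b d'"
  "c_form F t (s *s a) b d = s * c_form F t a b d"
  "c_form F t a (s *s b) d = s * c_form F t a b d"
  "c_form F t a b (s *s d) = s * c_form F t a b d"
  by (simp_all add: c_form_def distrib_left distrib_right sum.distrib sum_distrib_left mult_ac)

lemma eta_form_linear:
  "eta_form u F t (a + a') b = eta_form u F t a b + eta_form u F t a' b"
  "eta_form u F t a (b + b') = eta_form u F t a b + eta_form u F t a b'"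
  "eta_form u F t (s *s a) b = s * eta_form u F t a b"
  "eta_form u F t a (s *s b) = s * eta_form u F t a b"
  "eta_form u F t (a - a') b = eta_form u F t a b - eta_form u F t a' b"
  by (simp_all add: eta_form_def distrib_left distrib_right sum.distrib sum_distrib_left mult_ac
      left_diff_distrib right_diff_distrib sum_subtractf)

lemma c_form_unit: "c_form F t (axis u 1) a b = eta_form u F t a b"
proof -
  have "c_form F t (axis u 1) a b
      = (\<Sum>i\<in>UNIV. (\<Sum>j\<in>UNIV. \<Sum>k\<in>UNIV. third_deriv F t i j k * a $ j * b $ k) * axis u 1 $ i)"
    by (simp add: c_form_def sum_distrib_left sum_distrib_right mult_ac)
  also have "\<dots> = eta_form u F t a b"
    by (subst sum_mult_axis) (simp add: eta_form_def eta_def)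
  finally show ?thesis .
qed

locale prepotential =
  fixes M :: "('k::real_normed_field ^ 'm::finite) set" and u :: 'm and F :: "'k ^ 'm \<Rightarrow> 'k"
  assumes frobenius: "frobenius_manifold M u F"
begin

lemma open_M: "open M" and smooth_F: "smooth_on M F"
  using frobenius unfolding frobenius_manifold_def by blast+

lemma third_deriv_swap:
  assumes "t \<in> M"
  shows "third_deriv F t i j k = third_deriv F t j i k" "third_deriv F t i j k = third_deriv F t i k j"
proof -
  show "third_deriv F t i j k = third_deriv F t j i k"
    unfolding third_deriv_def
    by (rule smooth_on_partial_commute[OF open_M smooth_on_partial[OF smooth_F] assms])
  show "third_deriv F t i j k = third_deriv F t i k j"
    unfolding third_deriv_def
    by (rule partial_cong_open[OF open_M assms]) (rule smooth_on_partial_commute[OF open_M smooth_F])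
qed

lemma c_form_swap:
  assumes "t \<in> M"
  shows "c_form F t a b d = c_form F t b a d" "c_form F t a b d = c_form F t a d b"
proof -
  show "c_form F t a b d = c_form F t b a d"
    unfolding c_form_def
  proof (rule trans[OF sum.swap], intro sum.cong refl)
    fix i j k
    show "third_deriv F t j i k * a $ j * b $ i * d $ k = third_deriv F t i j k * b $ i * a $ j * d $ k"
      using third_deriv_swap(1)[OF assms, of i j k] by simp
  qed
  show "c_form F t a b d = c_form F t a d b"
    unfolding c_form_def
  proof (rule sum.cong[OF refl], rule trans[OF sum.swap], intro sum.cong refl)
    fix i j k
    show "third_deriv F t i k j * a $ i * b $ k * d $ j = third_deriv F t i j k * a $ i * d $ j * b $ k"
      using third_deriv_swap(2)[OF assms, of i j k] by simp
  qed
qed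

lemma eta_form_sym: "t \<in> M \<Longrightarrow> eta_form u F t a b = eta_form u F t b a"
  by (simp flip: c_form_unit add: c_form_swap(2)[of t _ a b])

text \<open>
  The inverse matrix in the structure constants cancels the metric, so lowering the raised index gives
  back the third derivatives. The metric is symmetric because third derivatives are.
\<close>
lemma eta_form_mult:
  assumes t: "t \<in> M"
  shows "eta_form u F t (mult u F t a b) d = c_form F t a b d"
proof -
  have "invertible (eta u F t)"
    using frobenius t unfolding frobenius_manifold_def by auto
  then have inv: "eta u F t ** matrix_inv (eta u F t) = mat 1" by (rule matrix_inv_cancel)
  have sym: "eta u F t $ k $ l = eta u F t $ l $ k" for k l
    using third_deriv_swap(2)[OF t, of u k l] by (simp add: eta_def)
  have raise: "(\<Sum>k\<in>UNIV. eta u F t $ k $ l * struct_const u F t i j k) = third_deriv F t i j l" for i j l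
  proof -
    have "(\<Sum>k\<in>UNIV. eta u F t $ k $ l * struct_const u F t i j k)
        = (eta u F t *v (matrix_inv (eta u F t) *v (\<chi> l. third_deriv F t i j l))) $ l"
      by (simp add: matrix_vector_mult_def struct_const_def sym[of _ l])
    also have "\<dots> = third_deriv F t i j l"
      by (simp add: matrix_vector_mul_assoc inv)
    finally show ?thesis .
  qed
  have "eta_form u F t (mult u F t a b) d =
     (\<Sum>k\<in>UNIV. \<Sum>l\<in>UNIV. \<Sum>i\<in>UNIV. \<Sum>j\<in>UNIV. eta u F t $ k $ l * struct_const u F t i j k * a $ i * b $ j * d $ l)"
    by (simp add: eta_form_def mult_def sum_distrib_left sum_distrib_right mult_ac)
  also have "\<dots> = (\<Sum>l\<in>UNIV. \<Sum>k\<in>UNIV. \<Sum>i\<in>UNIV. \<Sum>j\<in>UNIV. eta u F t $ k $ l * struct_const u F t i j k * a $ i * b $ j * d $ l)"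
    by (rule sum.swap)
  also have "\<dots> = (\<Sum>l\<in>UNIV. \<Sum>i\<in>UNIV. \<Sum>j\<in>UNIV. \<Sum>k\<in>UNIV. eta u F t $ k $ l * struct_const u F t i j k * a $ i * b $ j * d $ l)"
  proof (rule sum.cong[OF refl])
    fix l
    show "(\<Sum>k\<in>UNIV. \<Sum>i\<in>UNIV. \<Sum>j\<in>UNIV. eta u F t $ k $ l * struct_const u F t i j k * a $ i * b $ j * d $ l)
      = (\<Sum>i\<in>UNIV. \<Sum>j\<in>UNIV. \<Sum>k\<in>UNIV. eta u F t $ k $ l * struct_const u F t i j k * a $ i * b $ j * d $ l)"
      by (subst sum.swap) (intro sum.cong refl sum.swap)
  qed
  also have "\<dots> = (\<Sum>l\<in>UNIV. \<Sum>i\<in>UNIV. \<Sum>j\<in>UNIV. third_deriv F t i j l * a $ i * b $ j * d $ l)"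
    by (simp flip: raise add: sum_distrib_right)
  also have "\<dots> = (\<Sum>i\<in>UNIV. \<Sum>l\<in>UNIV. \<Sum>j\<in>UNIV. third_deriv F t i j l * a $ i * b $ j * d $ l)"
    by (rule sum.swap)
  also have "\<dots> = c_form F t a b d"
    unfolding c_form_def by (intro sum.cong refl sum.swap)
  finally show ?thesis .
qed

text \<open>
  The derivative in the direction of the unity can be moved inside, where it meets the constant metric.
\<close>
lemma third_deriv_constant_along_unity:
  assumes t: "t \<in> M"
  shows "partial u (\<lambda>t. third_deriv F t i j k) t = 0"
proof -
  obtain H where H: "\<And>t. t \<in> M \<Longrightarrow> eta u F t = H"
    using frobenius unfolding frobenius_manifold_def by blast
  define g where "g = partial j (partial k F)"
  have g: "smooth_on M g" unfolding g_def by (intro smooth_on_partial smooth_F)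
  have "partial u g s = H $ j $ k" if "s \<in> M" for s
    using H[OF that] by (auto simp: eta_def third_deriv_def g_def)
  then have "partial i (partial u g) t = 0"
    by (rule partial_const_on[OF open_M t])
  then have "partial u (partial i g) t = 0"
    by (simp add: smooth_on_partial_commute[OF open_M g t, of u i])
  then show ?thesis by (simp add: third_deriv_def[abs_def] g_def)
qed

text \<open>
  Of the eight terms of the expansion only the one without a factor \<open>axis u 1\<close> is not given by the
  metric, since \<open>c(e, a, b) = \<eta>(a, b)\<close> and \<open>c\<close> is symmetric.
\<close>
lemma c_form_null_frame:
  assumes t: "t \<in> M"
    and ee: "eta_form u F t (axis u 1) (axis u 1) = 0"
    and ew: "eta_form u F t (axis u 1) w = 1"
    and ww: "eta_form u F t w w = 0"
  shows "c_form F t (a1 *s axis u 1 + a2 *s w) (b1 *s axis u 1 + b2 *s w) (d1 *s axis u 1 + d2 *s w)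
    = (a1 * b1 + c_form F t w w w * a2 * b2) * d2 + (a1 * b2 + a2 * b1) * d1"
proof -
  let ?e = "axis u 1"
  have "eta_form u F t w ?e = 1" using ew eta_form_sym[OF t] by metis
  moreover have "c_form F t w ?e x = eta_form u F t w x" for x
    using c_form_swap(1)[OF t] c_form_unit by metis
  moreover have "c_form F t w w ?e = eta_form u F t w w"
    using c_form_swap[OF t] c_form_unit by metis
  ultimately show ?thesis
    by (simp add: c_form_linear c_form_unit ee ew ww algebra_simps)
qed

end

text \<open>
  Two candidates for the projection differ by a vector of \<open>T\<close> that is orthogonal to \<open>T\<close>, and such a
  vector is zero by nondegeneracy.
\<close>
lemma orthogonal_proj_eqI:
  fixes g :: "'v::ab_group_add \<Rightarrow> 'v \<Rightarrow> 'k::ab_group_add"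
  assumes nd: "nondegenerate_on T g" and diff: "\<And>a b. a \<in> T \<Longrightarrow> b \<in> T \<Longrightarrow> a - b \<in> T"
    and lin: "\<And>a b d. g (a - b) d = g a d - g b d"
    and w: "w \<in> T" "\<And>b. b \<in> T \<Longrightarrow> g v b = g w b"
  shows "orthogonal_proj T g v = w"
  unfolding orthogonal_proj_def
proof (rule the_equality)
  show "w \<in> T \<and> (\<forall>b\<in>T. g (v - w) b = 0)" using w by (simp add: lin)
  fix w' assume w': "w' \<in> T \<and> (\<forall>b\<in>T. g (v - w') b = 0)"
  then have "w' - w \<in> T" "\<forall>b\<in>T. g (w' - w) b = 0"
    using diff w by (auto simp: lin)
  then show "w' = w" using nd unfolding nondegenerate_on_def by force
qed

section \<open>Prepotentials in two variables\<close>

lemma partial_2I: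
  fixes f :: "'k::real_normed_field ^ 2 \<Rightarrow> 'k"
  assumes "(f has_derivative (\<lambda>v. a * v $ 1 + b * v $ 2)) (at x)"
  shows "partial 1 f x = a" "partial 2 f x = b"
proof -
  have "(f has_derivative (\<lambda>v. \<Sum>i\<in>UNIV. (if i = 1 then a else b) * v $ i)) (at x)"
    using assms by (simp add: sum_2)
  from partial_eqI[OF this] show "partial 1 f x = a" "partial 2 f x = b" by simp_all
qed

text \<open>
  Two-dimensional Frobenius structures with null coordinate fields are parametrized by one
  function of \<open>x $ 2\<close>: take \<open>G = x\<^sub>1\<^sup>2 x\<^sub>2 / 2 + C\<^sub>3\<close> where \<open>C\<^sub>3\<close> is a threefold primitive of \<open>c\<close>.
\<close>
lemma exists_prepotential_2:
  fixes c :: "'k::{real_normed_field,euclidean_space} ^ 2 \<Rightarrow> 'k"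
  assumes r: "r > 0" and c: "constant_along_on 1 (ball x0 r) c"
  obtains G where "frobenius_manifold (ball x0 r) 1 G"
    "\<And>x. x \<in> ball x0 r \<Longrightarrow> eta 1 G x = (\<chi> i j. if i = j then 0 else 1)"
    "\<And>x a b. x \<in> ball x0 r \<Longrightarrow>
       mult 1 G x a b = (a $ 1 * b $ 1 + c x * a $ 2 * b $ 2) *s axis 1 1 + (a $ 1 * b $ 2 + a $ 2 * b $ 1) *s axis 2 1"
proof -
  define B where "B = ball x0 r"
  have B: "open B" by (simp add: B_def)
  have prim: "\<exists>C. constant_along_on 1 B C \<and> (\<forall>x\<in>B. (C has_derivative (\<lambda>v. h x * v $ 2)) (at x))"
    if inv: "constant_along_on 1 B h" for h :: "'k ^ 2 \<Rightarrow> 'k"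
  proof -
    obtain P where P: "smooth_on B (\<lambda>x. P (x $ 2))"
        "\<And>x. x \<in> B \<Longrightarrow> ((\<lambda>x. P (x $ 2)) has_derivative (\<lambda>v. h x * v $ 2)) (at x)"
    proof -
      have "smooth_on (ball x0 r) h" "\<And>x. x \<in> ball x0 r \<Longrightarrow> partial 1 h x = 0"
        using inv by (simp_all add: constant_along_on_def B_def)
      from primitive_in_second_coordinate[OF r this] that show thesis
        unfolding B_def by metis
    qed
    have "partial 1 (\<lambda>x. P (x $ 2)) x = 0" if "x \<in> B" for x
      by (rule partial_2I(1)[of _ _ "h x"]) (use P(2)[OF that] in simp)
    with P show ?thesis unfolding constant_along_on_def by blast
  qed
  obtain C1 where C1: "constant_along_on 1 B C1" "\<And>x. x \<in> B \<Longrightarrow> (C1 has_derivative (\<lambda>v. c x * v $ 2)) (at x)"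
    using prim c unfolding B_def by blast
  obtain C2 where C2: "constant_along_on 1 B C2" "\<And>x. x \<in> B \<Longrightarrow> (C2 has_derivative (\<lambda>v. C1 x * v $ 2)) (at x)"
    using prim C1(1) by blast
  obtain C3 where C3: "constant_along_on 1 B C3" "\<And>x. x \<in> B \<Longrightarrow> (C3 has_derivative (\<lambda>v. C2 x * v $ 2)) (at x)"
    using prim C2(1) by blast
  define G where "G = (\<lambda>x. (1 / 2) * (x $ 1 * x $ 1) * x $ 2 + C3 x)"
  have nth: "((\<lambda>x. x $ i) has_derivative (\<lambda>v. v $ i)) (at x)" for i :: 2 and x :: "'k ^ 2"
    by (rule bounded_linear_imp_has_derivative[OF bounded_linear_vec_nth])
  have smG: "smooth_on B G"
    unfolding G_def using C3(1)
    by (intro smooth_on_add smooth_on_mult smooth_on_nth smooth_on_const B) (simp add: constant_along_on_def)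
  have dG: "partial 1 G x = x $ 1 * x $ 2" "partial 2 G x = (1 / 2) * (x $ 1 * x $ 1) + C2 x" if "x \<in> B" for x
  proof -
    have "(G has_derivative (\<lambda>v. (x $ 1 * x $ 2) * v $ 1 + ((1 / 2) * (x $ 1 * x $ 1) + C2 x) * v $ 2)) (at x)"
      unfolding G_def by (rule derivative_eq_intros nth C3(2)[OF that] refl)+ (simp add: field_simps)
    from partial_2I[OF this] show "partial 1 G x = x $ 1 * x $ 2" "partial 2 G x = (1 / 2) * (x $ 1 * x $ 1) + C2 x" .
  qed
  have d2: "partial 1 (partial 1 G) x = x $ 2" "partial 2 (partial 1 G) x = x $ 1"
     "partial 1 (partial 2 G) x = x $ 1" "partial 2 (partial 2 G) x = C1 x" if x: "x \<in> B" for x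
  proof -
    have "((\<lambda>x. x $ 1 * x $ 2) has_derivative (\<lambda>v. x $ 2 * v $ 1 + x $ 1 * v $ 2)) (at x)"
      by (rule derivative_eq_intros nth refl)+ (simp add: field_simps)
    from partial_2I[OF this] show "partial 1 (partial 1 G) x = x $ 2" "partial 2 (partial 1 G) x = x $ 1"
      using partial_cong_open[OF B x, of "partial 1 G" "\<lambda>x. x $ 1 * x $ 2"] dG(1) by simp_all
    have "((\<lambda>x. (1 / 2) * (x $ 1 * x $ 1) + C2 x) has_derivative (\<lambda>v. x $ 1 * v $ 1 + C1 x * v $ 2)) (at x)"
      by (rule derivative_eq_intros nth C2(2)[OF that] refl)+ (simp add: field_simps)
    from partial_2I[OF this] show "partial 1 (partial 2 G) x = x $ 1" "partial 2 (partial 2 G) x = C1 x"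
      using partial_cong_open[OF B x, of "partial 2 G" "\<lambda>x. (1 / 2) * (x $ 1 * x $ 1) + C2 x"] dG(2) by simp_all
  qed
  have third: "third_deriv G x i 1 1 = (if i = 1 then 0 else 1)" "third_deriv G x i 2 1 = (if i = 1 then 1 else 0)"
     "third_deriv G x i 1 2 = (if i = 1 then 1 else 0)" "third_deriv G x i 2 2 = (if i = 1 then 0 else c x)" if x: "x \<in> B" for x i
  proof -
    have 1: "((\<lambda>x. x $ 1) has_derivative (\<lambda>v. 1 * v $ 1 + 0 * v $ 2)) (at x)"
      and 2: "((\<lambda>x. x $ 2) has_derivative (\<lambda>v. 0 * v $ 1 + 1 * v $ 2)) (at x)"
      and 3: "(C1 has_derivative (\<lambda>v. 0 * v $ 1 + c x * v $ 2)) (at x)"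
      using nth C1(2)[OF x] by simp_all
    show "third_deriv G x i 1 1 = (if i = 1 then 0 else 1)"
      using partial_cong_open[OF B x, of "partial 1 (partial 1 G)" "\<lambda>x. x $ 2" i] d2(1) partial_2I[OF 2] exhaust_2[of i] by (auto simp: third_deriv_def)
    show "third_deriv G x i 2 1 = (if i = 1 then 1 else 0)"
      using partial_cong_open[OF B x, of "partial 2 (partial 1 G)" "\<lambda>x. x $ 1" i] d2(2) partial_2I[OF 1] exhaust_2[of i] by (auto simp: third_deriv_def)
    show "third_deriv G x i 1 2 = (if i = 1 then 1 else 0)"
      using partial_cong_open[OF B x, of "partial 1 (partial 2 G)" "\<lambda>x. x $ 1" i] d2(3) partial_2I[OF 1] exhaust_2[of i] by (auto simp: third_deriv_def)
    show "third_deriv G x i 2 2 = (if i = 1 then 0 else c x)"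
      using partial_cong_open[OF B x, of "partial 2 (partial 2 G)" "C1" i] d2(4) partial_2I[OF 3] exhaust_2[of i] by (auto simp: third_deriv_def)
  qed
  define H :: "'k ^ 2 ^ 2" where "H = (\<chi> i j. if i = j then 0 else 1)"
  have HH: "H ** H = mat 1"
    by (simp add: H_def matrix_matrix_mult_def mat_def vec_eq_iff forall_2 sum_2)
  have eta: "eta 1 G x = H" if "x \<in> B" for x
    by (simp add: eta_def H_def vec_eq_iff forall_2 third[OF that])
  have mult: "mult 1 G x a b = (a $ 1 * b $ 1 + c x * a $ 2 * b $ 2) *s axis 1 1 + (a $ 1 * b $ 2 + a $ 2 * b $ 1) *s axis 2 1"
    if "x \<in> B" for x a b
    by (simp add: mult_def struct_const_def eta[OF that] matrix_inv_eqI[OF HH] vec_eq_iff forall_2 sum_2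
        third[OF that] axis_def) (simp add: H_def mult_ac)
  have "frobenius_manifold B 1 G"
    unfolding frobenius_manifold_def
  proof (intro conjI ballI allI)
    show "connected B" "B \<noteq> {}" using r by (simp_all add: B_def)
    have "invertible H" using HH unfolding invertible_def by blast
    then show "\<exists>H. invertible H \<and> (\<forall>t\<in>B. eta 1 G t = H)" using eta by blast
  qed (auto simp: B smG mult vec_eq_iff forall_2 axis_def algebra_simps)
  from that[OF this[unfolded B_def] eta[unfolded B_def H_def] mult[unfolded B_def]] show thesis .
qed

section \<open>Null coordinates on a surface tangent to the unity\<close>

lemma sum_2_axis: "v = v $ 1 *s axis 1 1 + v $ 2 *s axis 2 1" for v :: "'k::semiring_1 ^ 2"
  by (simp add: vec_eq_iff forall_2 axis_def)

lemma jacobian_matrix_axis: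
  "(jacobian_matrix \<phi> x *v axis \<alpha> 1) $ i = partial \<alpha> (\<lambda>y. \<phi> y $ i) x"
  by (simp add: matrix_vector_mult_def sum_mult_axis jacobian_matrix_def)

lemma matrix_vector_mult_2:
  fixes A :: "'k::field ^ 2 ^ 'm"
  shows "A *v v = v $ 1 *s (A *v axis 1 1) + v $ 2 *s (A *v axis 2 1)"
  by (subst sum_2_axis[of v]) (simp only: matrix_vector_right_distrib vector_scalar_commute)

text \<open>
  Dimension two is not part of these conditions; it enters through parametrizations by \<open>'k ^ 2\<close>.
\<close>
locale unity_tangent_surface = prepotential M u F
  for M :: "('k::{real_normed_field,euclidean_space} ^ 'm::finite) set" and u and F +
  fixes N and \<iota>
  assumes antidiagonal: "antidiagonal_coordinates \<iota> M u F"
    and N_sub: "N \<subseteq> M"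
    and nondegenerate: "p \<in> N \<Longrightarrow> nondegenerate_on (tangent_space N p) (eta_form u F p)"
    and unity_tangent: "p \<in> N \<Longrightarrow> axis u 1 \<in> tangent_space N p"
begin

text \<open>
  The index of the coordinate \<open>t\<^sup>m\<close>, the one paired with \<open>t\<^sup>1\<close> by the antidiagonal metric.
\<close>
definition dual_index :: 'm where
  "dual_index = inv_into UNIV \<iota> CARD('m)"

lemma eta_form_unity:
  assumes "t \<in> M"
  shows "eta_form u F t (axis u 1) b = b $ dual_index"
proof -
  have bij: "bij_betw \<iota> UNIV {1..CARD('m)}" and u: "\<iota> u = 1"
    and eta: "\<And>i j. eta u F t $ i $ j = (if \<iota> i + \<iota> j = CARD('m) + 1 then 1 else 0)"
    using antidiagonal assms unfolding antidiagonal_coordinates_def by blast+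
  have "CARD('m) \<in> \<iota> ` UNIV"
    using bij by (simp add: bij_betw_def Suc_leI)
  then have d: "\<iota> dual_index = CARD('m)"
    unfolding dual_index_def by (rule f_inv_into_f)
  have "inj \<iota>" using bij by (simp add: bij_betw_def)
  then have "\<iota> j = CARD('m) \<longleftrightarrow> j = dual_index" for j
    using d by (metis injD)
  then have eta_u: "eta u F t $ u $ j = (if j = dual_index then 1 else 0)" for j
    by (simp add: eta u)
  have "eta_form u F t (axis u 1) b = (\<Sum>i\<in>UNIV. (\<Sum>j\<in>UNIV. eta u F t $ i $ j * b $ j) * axis u 1 $ i)"
    by (simp add: eta_form_def sum_distrib_left sum_distrib_right mult_ac)
  also have "\<dots> = (\<Sum>j\<in>UNIV. eta u F t $ u $ j * b $ j)"
    by (simp add: sum_mult_axis)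
  also have "\<dots> = (\<Sum>j\<in>UNIV. b $ j * axis dual_index 1 $ j)"
    by (intro sum.cong) (auto simp: eta_u axis_def)
  also have "\<dots> = b $ dual_index" by (simp add: sum_mult_axis)
  finally show ?thesis .
qed

lemma dual_index_neq:
  assumes "1 < CARD('m)"
  shows "dual_index \<noteq> u"
proof
  assume "dual_index = u"
  have bij: "bij_betw \<iota> UNIV {1..CARD('m)}" and u: "\<iota> u = 1"
    using antidiagonal unfolding antidiagonal_coordinates_def by blast+
  have "CARD('m) \<in> \<iota> ` UNIV"
    using bij by (simp add: bij_betw_def Suc_leI)
  then have d: "\<iota> dual_index = CARD('m)"
    unfolding dual_index_def by (rule f_inv_into_f)
  with \<open>dual_index = u\<close> u assms show False by simp
qed

text \<open>
  The coordinates \<open>t\<^sup>1\<close> and \<open>t\<^sup>m\<close> restrict to local coordinates on \<open>N\<close>. On the tangent plane \<open>dt\<^sup>m\<close> is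
  \<open>\<eta>(e, -)\<close>; it vanishes at \<open>e\<close> but, by nondegeneracy, not at some other tangent vector, while
  \<open>dt\<^sup>1(e) = 1\<close>. So the two differentials are independent. That \<open>m \<ge> 2\<close>, and hence \<open>t\<^sup>m \<noteq> t\<^sup>1\<close>, is invariance of
  dimension.
\<close>
lemma graph_parametrization:
  fixes \<phi>0 :: "'k ^ 2 \<Rightarrow> 'k ^ 'm"
  assumes lp: "local_parametrization N U0 \<phi>0" and x0: "x0 \<in> U0"
  obtains y0 r and \<phi> :: "'k ^ 2 \<Rightarrow> 'k ^ 'm" where "r > 0" "local_parametrization N (ball y0 r) \<phi>" "\<phi> y0 = \<phi>0 x0"
    "\<And>y. y \<in> ball y0 r \<Longrightarrow> \<phi> y $ u = y $ 1" "\<And>y. y \<in> ball y0 r \<Longrightarrow> \<phi> y $ dual_index = y $ 2"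
    "dual_index \<noteq> u"
proof -
  note U = local_parametrizationD[OF lp]
  let ?J = "jacobian_matrix \<phi>0 x0"
  have "inj_on \<phi>0 U0"
    using lp unfolding local_parametrization_def homeomorphism_def by (metis inj_on_inverseI)
  with U(1,6) x0 have "DIM('k ^ 2) \<le> DIM('k ^ 'm)"
    by (intro invariance_of_dimension[of U0 \<phi>0]) auto
  then have "1 < CARD('m)"
    by (simp add: DIM_positive)
  then have du: "dual_index \<noteq> u" by (rule dual_index_neq)
  have pN: "\<phi>0 x0 \<in> N" using U(5) x0 by blast
  then have pM: "\<phi>0 x0 \<in> M" using N_sub by blast
  have T: "tangent_space N (\<phi>0 x0) = range (\<lambda>a. ?J *v a)"
    by (rule tangent_space_eq_range[OF lp x0])
  obtain a where a: "axis u 1 = ?J *v a"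
    using unity_tangent[OF pN] unfolding T by blast
  have "(axis u 1 :: 'k ^ 'm) \<noteq> 0" by simp
  then obtain b where b: "(?J *v b) $ dual_index \<noteq> 0"
    using nondegenerate[OF pN] unity_tangent[OF pN] eta_form_unity[OF pM]
    unfolding nondegenerate_on_def T by fastforce
  define \<Psi> where "\<Psi> = (\<lambda>x. \<chi> i::2. if i = 1 then \<phi>0 x $ u else \<phi>0 x $ dual_index)"
  have sm\<Psi>: "smooth_on U0 (\<lambda>x. \<Psi> x $ i)" for i
    using U(2) by (cases "i = 1") (simp_all add: \<Psi>_def)
  define A where "A = jacobian_matrix \<Psi> x0"
  have A: "A $ 1 $ \<alpha> = ?J $ u $ \<alpha>" "A $ 2 $ \<alpha> = ?J $ dual_index $ \<alpha>" for \<alpha>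
    by (simp_all add: A_def \<Psi>_def jacobian_matrix_def)
  have Jv: "(?J *v v) $ i = ?J $ i $ 1 * v $ 1 + ?J $ i $ 2 * v $ 2" for v i
    by (simp add: matrix_vector_mult_def sum_2)
  have "(?J *v a) $ u = 1" "(?J *v a) $ dual_index = 0"
    using du by (simp_all flip: a add: axis_def)
  \<comment> \<open>Expand \<open>dt\<^sup>1(a) dt\<^sup>m(b) - dt\<^sup>1(b) dt\<^sup>m(a)\<close>, where \<open>a\<close> represents the unity.\<close>
  then have "(?J *v b) $ dual_index = det A * (a $ 1 * b $ 2 - a $ 2 * b $ 1)"
    unfolding det_2 A Jv by algebra
  with b have "det (jacobian_matrix \<Psi> x0) \<noteq> 0" unfolding A_def by auto
  from smooth_inverse_function_theorem[OF U(1) x0 sm\<Psi> this]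
  obtain U' V g where g: "open U'" "U' \<subseteq> U0" "x0 \<in> U'" "open V" "\<Psi> x0 \<in> V" "homeomorphism U' V \<Psi> g"
    "\<And>i. smooth_on V (\<lambda>y. g y $ i)" "\<And>y. y \<in> V \<Longrightarrow> inj (\<lambda>a. jacobian_matrix g y *v a)"
    by blast
  obtain r where r: "r > 0" "ball (\<Psi> x0) r \<subseteq> V"
    using g(4,5) openE by blast
  have \<Psi>g: "\<Psi> (g y) = y" if "y \<in> V" for y
    using homeomorphism_apply2[OF g(6) that] .
  have "local_parametrization N V (\<lambda>y. \<phi>0 (g y))"
  proof (rule local_parametrization_reparametrize(1)[OF lp g(4)])
    show "g ` V \<subseteq> U0" using g(2,6) by (auto simp: homeomorphism_def)
    show "inj_on g V" using \<Psi>g by (metis inj_on_inverseI)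
  qed (use g(7,8) in auto)
  then have 1: "local_parametrization N (ball (\<Psi> x0) r) (\<lambda>y. \<phi>0 (g y))"
    by (rule local_parametrization_subset) (use r in auto)
  have 2: "\<phi>0 (g (\<Psi> x0)) = \<phi>0 x0"
    using homeomorphism_apply1[OF g(6) g(3)] by simp
  have 3: "\<phi>0 (g y) $ u = y $ 1" "\<phi>0 (g y) $ dual_index = y $ 2" if "y \<in> ball (\<Psi> x0) r" for y
  proof -
    have "\<Psi> (g y) = y" using \<Psi>g that r by blast
    then have "\<Psi> (g y) $ 1 = y $ 1" "\<Psi> (g y) $ 2 = y $ 2" by simp_all
    then show "\<phi>0 (g y) $ u = y $ 1" "\<phi>0 (g y) $ dual_index = y $ 2" by (simp_all add: \<Psi>_def)
  qed
  from that[OF r(1) 1 2 3 du] show thesis .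
qed

text \<open>
  A tangent vector is determined by its components in the directions \<open>t\<^sup>1\<close> and \<open>t\<^sup>m\<close>; for the unity
  they are \<open>1\<close> and \<open>0\<close>.
\<close>
lemma unity_in_graph_parametrization:
  fixes \<phi> :: "'k ^ 2 \<Rightarrow> 'k ^ 'm"
  assumes lp: "local_parametrization N U \<phi>" and du: "dual_index \<noteq> u"
    and gr: "\<And>y. y \<in> U \<Longrightarrow> \<phi> y $ u = y $ 1" "\<And>y. y \<in> U \<Longrightarrow> \<phi> y $ dual_index = y $ 2"
    and y: "y \<in> U"
  shows "jacobian_matrix \<phi> y *v axis 1 1 = axis u 1"
    and "(jacobian_matrix \<phi> y *v axis 2 1) $ dual_index = 1"
proof -
  note U = local_parametrizationD[OF lp]
  let ?J = "jacobian_matrix \<phi> y"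
  have nth: "((\<lambda>x. x $ i) has_derivative (\<lambda>v. v $ i)) (at x)" for i :: 2 and x :: "'k ^ 2"
    by (rule bounded_linear_imp_has_derivative[OF bounded_linear_vec_nth])
  have "partial \<alpha> (\<lambda>y. \<phi> y $ u) y = partial \<alpha> (\<lambda>y. y $ 1) y"
    "partial \<alpha> (\<lambda>y. \<phi> y $ dual_index) y = partial \<alpha> (\<lambda>y. y $ 2) y" for \<alpha>
    using partial_cong_open[OF U(1) y, of "\<lambda>y. \<phi> y $ u" "\<lambda>y. y $ 1"] gr(1)
      partial_cong_open[OF U(1) y, of "\<lambda>y. \<phi> y $ dual_index" "\<lambda>y. y $ 2"] gr(2) by simp_all
  then have J: "(?J *v axis 1 1) $ u = 1" "(?J *v axis 2 1) $ u = 0"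
    "(?J *v axis 1 1) $ dual_index = 0" "(?J *v axis 2 1) $ dual_index = 1"
    unfolding jacobian_matrix_axis
    using partial_2I[of "\<lambda>y. y $ 1" 1 0 y] partial_2I[of "\<lambda>y. y $ 2" 0 1 y] nth by simp_all
  then show "(?J *v axis 2 1) $ dual_index = 1" by simp
  have "\<phi> y \<in> N" using U(5) y by blast
  then obtain a where a: "axis u 1 = ?J *v a"
    using unity_tangent tangent_space_eq_range[OF lp y] by blast
  have a': "axis u 1 = a $ 1 *s (?J *v axis 1 1) + a $ 2 *s (?J *v axis 2 1)"
    using a matrix_vector_mult_2[of ?J a] by simp
  have "a $ 1 = 1" "a $ 2 = 0"
    using arg_cong[OF a', of "\<lambda>v. v $ u"] arg_cong[OF a', of "\<lambda>v. v $ dual_index"] J du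
    by (simp_all add: axis_def)
  with a' show "?J *v axis 1 1 = axis u 1" by simp
qed

text \<open>
  If the first coordinate field is the constant vector field \<open>e\<close>, then by symmetry of second
  derivatives the coordinate fields do not change in the first direction, and neither do the \<open>c\<^sub>i\<^sub>j\<^sub>k\<close>, whose
  derivative in direction \<open>e\<close> vanishes. For \<open>\<alpha> = 1\<close> this covers the induced metric, as \<open>c(e, a, b) = \<eta>(a, b)\<close>.
\<close>
lemma c_form_constant_along_unity:
  fixes \<phi> :: "'k ^ 2 \<Rightarrow> 'k ^ 'm"
  assumes lp: "local_parametrization N U \<phi>"
    and e: "\<And>y. y \<in> U \<Longrightarrow> jacobian_matrix \<phi> y *v axis 1 1 = axis u 1"
  shows "constant_along_on 1 U (\<lambda>y. c_form F (\<phi> y) (jacobian_matrix \<phi> y *v axis \<alpha> 1)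
      (jacobian_matrix \<phi> y *v axis \<beta> 1) (jacobian_matrix \<phi> y *v axis \<gamma> 1))"
proof -
  note U = local_parametrizationD[OF lp]
  have sub: "\<phi> ` U \<subseteq> M" using U(5) N_sub by blast
  have p1: "partial 1 (\<lambda>y. \<phi> y $ i) y = axis u 1 $ i" if "y \<in> U" for y i
    using arg_cong[OF e[OF that], of "\<lambda>v. v $ i"] by (simp add: jacobian_matrix_axis)
  have J: "constant_along_on 1 U (\<lambda>y. (jacobian_matrix \<phi> y *v axis \<alpha> 1) $ i)" for \<alpha> i
    unfolding jacobian_matrix_axis constant_along_on_def
  proof (intro conjI ballI)
    show "smooth_on U (partial \<alpha> (\<lambda>y. \<phi> y $ i))" by (rule smooth_on_partial[OF U(2)])
    fix y assume y: "y \<in> U"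
    have "partial 1 (partial \<alpha> (\<lambda>y. \<phi> y $ i)) y = partial \<alpha> (partial 1 (\<lambda>y. \<phi> y $ i)) y"
      by (rule smooth_on_partial_commute[OF U(1) U(2) y])
    also have "\<dots> = 0" by (rule partial_const_on[OF U(1) y p1])
    finally show "partial 1 (partial \<alpha> (\<lambda>y. \<phi> y $ i)) y = 0" .
  qed
  have c: "constant_along_on 1 U (\<lambda>y. third_deriv F (\<phi> y) i j k)" for i j k
    unfolding constant_along_on_def
  proof (intro conjI ballI)
    have sm: "smooth_on M (\<lambda>t. third_deriv F t i j k)"
      unfolding third_deriv_def by (intro smooth_on_partial smooth_F)
    show "smooth_on U (\<lambda>y. third_deriv F (\<phi> y) i j k)"
      by (rule smooth_on_compose[OF U(1) sub sm U(2)])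
    fix y assume y: "y \<in> U"
    then have yM: "\<phi> y \<in> M" using sub by blast
    have "partial 1 (\<lambda>y. third_deriv F (\<phi> y) i j k) y
        = (\<Sum>l\<in>UNIV. partial l (\<lambda>t. third_deriv F t i j k) (\<phi> y) * partial 1 (\<lambda>y. \<phi> y $ l) y)"
      by (rule partial_eqI, rule has_derivative_compose_components)
         (rule smooth_onD[OF sm yM], rule smooth_onD[OF U(2) y])
    also have "\<dots> = 0"
      by (simp add: p1[OF y] sum_mult_axis third_deriv_constant_along_unity[OF yM])
    finally show "partial 1 (\<lambda>y. third_deriv F (\<phi> y) i j k) y = 0" .
  qed
  show ?thesis
    unfolding c_form_def by (intro constant_along_on_sum constant_along_on_mult J c U(1))
qed

text \<open>
  In the graph parametrization only \<open>h = \<eta>(w, w)\<close> can fail to be constant. It depends on the second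
  coordinate alone, so the shear \<open>S x = (x\<^sub>1 + P(x\<^sub>2), x\<^sub>2)\<close> with \<open>P' = - h / 2\<close> is a coordinate change. It keeps
  the first coordinate field and replaces \<open>w\<close> by \<open>w - (h / 2) e\<close>, whose square is \<open>h - h = 0\<close>.
\<close>
lemma null_parametrization:
  fixes \<phi>0 :: "'k ^ 2 \<Rightarrow> 'k ^ 'm"
  assumes lp0: "local_parametrization N U0 \<phi>0" and x0: "x0 \<in> U0"
  obtains y0 r and \<phi> :: "'k ^ 2 \<Rightarrow> 'k ^ 'm" where "r > 0" "local_parametrization N (ball y0 r) \<phi>" "\<phi> y0 = \<phi>0 x0"
    "\<And>y. y \<in> ball y0 r \<Longrightarrow> jacobian_matrix \<phi> y *v axis 1 1 = axis u 1"
    "\<And>y. y \<in> ball y0 r \<Longrightarrow> eta_form u F (\<phi> y) (axis u 1) (axis u 1) = 0"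
    "\<And>y. y \<in> ball y0 r \<Longrightarrow> eta_form u F (\<phi> y) (axis u 1) (jacobian_matrix \<phi> y *v axis 2 1) = 1"
    "\<And>y. y \<in> ball y0 r \<Longrightarrow>
       eta_form u F (\<phi> y) (jacobian_matrix \<phi> y *v axis 2 1) (jacobian_matrix \<phi> y *v axis 2 1) = 0"
proof -
  obtain y0 r and \<phi> :: "'k ^ 2 \<Rightarrow> 'k ^ 'm" where r: "r > 0" and lp: "local_parametrization N (ball y0 r) \<phi>" and \<phi>y0: "\<phi> y0 = \<phi>0 x0"
    and gr: "\<And>y. y \<in> ball y0 r \<Longrightarrow> \<phi> y $ u = y $ 1" "\<And>y. y \<in> ball y0 r \<Longrightarrow> \<phi> y $ dual_index = y $ 2"
    and du: "dual_index \<noteq> u"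
  proof (rule graph_parametrization[OF lp0 x0], goal_cases)
    case (1 y0 r \<phi>)
    show ?case by (rule 1(1)) (fact 1)+
  qed
  define B where "B = ball y0 r"
  note U = local_parametrizationD[OF lp, folded B_def]
  define w where "w = (\<lambda>y. jacobian_matrix \<phi> y *v axis 2 1)"
  have e: "jacobian_matrix \<phi> y *v axis 1 1 = axis u 1" and w: "w y $ dual_index = 1" if "y \<in> B" for y
    using unity_in_graph_parametrization[OF lp du gr] that unfolding B_def w_def by blast+
  have inM: "\<phi> y \<in> M" if "y \<in> B" for y using U(5) N_sub that by blast
  define h where "h = (\<lambda>y. eta_form u F (\<phi> y) (w y) (w y))"
  have "constant_along_on 1 B (\<lambda>y. c_form F (\<phi> y) (jacobian_matrix \<phi> y *v axis 1 1) (w y) (w y))"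
    unfolding w_def B_def by (rule c_form_constant_along_unity[OF lp]) (rule e[unfolded B_def])
  then have "constant_along_on 1 B (\<lambda>y. (- 1 / 2) * c_form F (\<phi> y) (jacobian_matrix \<phi> y *v axis 1 1) (w y) (w y))"
    by (intro constant_along_on_mult constant_along_on_const) (simp_all add: B_def)
  \<comment> \<open>The metric \<open>h\<close> enters as \<open>c(e, w, w)\<close>, whose constancy along the first coordinate is known.\<close>
  moreover define k where "k = (\<lambda>y. (- 1 / 2) * c_form F (\<phi> y) (jacobian_matrix \<phi> y *v axis 1 1) (w y) (w y))"
  ultimately have k: "smooth_on (ball y0 r) k" "\<And>y. y \<in> ball y0 r \<Longrightarrow> partial 1 k y = 0"
    unfolding constant_along_on_def B_def by blast+
  have kh: "k y = - h y / 2" if "y \<in> B" for y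
    by (simp add: k_def e[OF that] c_form_unit h_def)
  obtain P where P0: "P (y0 $ 2) = 0" and Psm: "smooth_on B (\<lambda>x. P (x $ 2))"
    and P': "\<And>x. x \<in> B \<Longrightarrow> (P has_field_derivative k x) (at (x $ 2))"
    and dP: "\<And>x. x \<in> B \<Longrightarrow> ((\<lambda>x. P (x $ 2)) has_derivative (\<lambda>v. k x * v $ 2)) (at x)"
    unfolding B_def
  proof (rule primitive_in_second_coordinate[OF r k], goal_cases)
    case (2 P)
    show ?case by (rule 2(1)) (fact 2)+
  qed
  define S :: "'k ^ 2 \<Rightarrow> 'k ^ 2" where "S = (\<lambda>x. \<chi> i::2. if i = 1 then x $ 1 + P (x $ 2) else x $ 2)"
  have S: "S x $ 1 = x $ 1 + P (x $ 2)" "S x $ 2 = x $ 2" for x by (simp_all add: S_def)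
  have smS: "smooth_on B (\<lambda>x. S x $ i)" for i
  proof (cases "i = 1")
    case True
    then show ?thesis unfolding True S
      by (intro smooth_on_add smooth_on_nth Psm) (simp_all add: B_def)
  next
    case False
    then have "i = 2" using exhaust_2 by blast
    then show ?thesis by (simp add: S smooth_on_nth B_def)
  qed
  have dS: "(S has_derivative (\<lambda>v. \<chi> i::2. if i = 1 then v $ 1 - h x / 2 * v $ 2 else v $ 2)) (at x)" if "x \<in> B" for x
  proof (rule has_derivative_vecI)
    fix i :: 2
    have nth: "((\<lambda>x. x $ i) has_derivative (\<lambda>v. v $ i)) (at x)" for i :: 2 and x :: "'k ^ 2"
      by (rule bounded_linear_imp_has_derivative[OF bounded_linear_vec_nth])
    show "((\<lambda>x. S x $ i) has_derivative (\<lambda>v. (\<chi> i::2. if i = 1 then v $ 1 - h x / 2 * v $ 2 else v $ 2) $ i)) (at x)"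
      using has_derivative_add[OF nth[of 1] dP[OF that]] nth[of 2] exhaust_2[of i] by (auto simp: S kh[OF that])
  qed
  have JS: "jacobian_matrix S x *v v = (\<chi> i::2. if i = 1 then v $ 1 - h x / 2 * v $ 2 else v $ 2)" if "x \<in> B" for x v
    using has_derivative_unique[OF has_derivative_jacobian[OF smS that] dS[OF that]] by metis
  have "S y0 = y0" by (simp add: vec_eq_iff forall_2 S P0)
  moreover have "continuous_on B S"
    using dS has_derivative_continuous by (blast intro: continuous_at_imp_continuous_on)
  then have "open (S -` B \<inter> B)"
    by (rule continuous_on_open_vimage[THEN iffD1, rule_format, rotated]) (simp_all add: B_def)
  \<comment> \<open>Primitives are known on balls only, so the domain on which \<open>S\<close> stays in \<open>B\<close> is shrunk to one.\<close>
  ultimately obtain r' where r': "r' > 0" "ball y0 r' \<subseteq> S -` B \<inter> B"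
    using r openE[of "S -` B \<inter> B" y0] by (auto simp: B_def)
  define W where "W = ball y0 r'"
  have WB: "W \<subseteq> B" and SW: "S ` W \<subseteq> B" using r' by (auto simp: W_def)
  have injS: "inj_on S W"
  proof (rule inj_onI)
    fix x y assume "S x = S y"
    then have "S x $ 1 = S y $ 1" "S x $ 2 = S y $ 2" by simp_all
    then show "x = y" by (simp add: S vec_eq_iff forall_2)
  qed
  have injJ: "inj (\<lambda>a. jacobian_matrix S x *v a)" if "x \<in> W" for x
  proof (rule injI)
    have x: "x \<in> B" using that WB by blast
    fix a b assume "jacobian_matrix S x *v a = jacobian_matrix S x *v b"
    then show "a = b" unfolding JS[OF x] by (auto simp: vec_eq_iff forall_2)
  qed
  define \<phi>2 where "\<phi>2 = (\<lambda>x. \<phi> (S x))"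
  have smSW: "smooth_on W (\<lambda>x. S x $ i)" for i
    by (rule smooth_on_subset[OF smS WB])
  have oW: "open W" by (simp add: W_def)
  note reparametrize = local_parametrization_reparametrize[OF lp[folded B_def] oW SW injS smSW]
  have rep: "local_parametrization N W \<phi>2"
    "\<And>x. x \<in> W \<Longrightarrow> jacobian_matrix \<phi>2 x = jacobian_matrix \<phi> (S x) ** jacobian_matrix S x"
    unfolding \<phi>2_def
    by (rule reparametrize(1)) (rule injJ, assumption, rule reparametrize(2), rule injJ)
  have J1: "jacobian_matrix \<phi>2 x *v axis 1 1 = axis u 1" if "x \<in> W" for x
  proof -
    have x: "x \<in> B" "S x \<in> B" using WB SW that by auto
    have "jacobian_matrix S x *v axis 1 1 = axis 1 1"
      by (simp add: JS[OF x(1)] vec_eq_iff forall_2 axis_def)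
    then show ?thesis
      by (simp add: rep(2)[OF that] e[OF x(2)] flip: matrix_vector_mul_assoc)
  qed
  have J2: "jacobian_matrix \<phi>2 x *v axis 2 1 = (- h (S x) / 2) *s axis u 1 + w (S x)" if "x \<in> W" for x
  proof -
    have x: "x \<in> B" "S x \<in> B" using WB SW that by auto
    \<comment> \<open>Both values are the derivative of \<open>P\<close> at the same point, as \<open>S\<close> preserves the second coordinate.\<close>
    have "k x = k (S x)"
      by (rule DERIV_unique[OF P'[OF x(1)]]) (use P'[OF x(2)] in \<open>simp add: S\<close>)
    then have "- h x / 2 = - h (S x) / 2" by (simp only: kh x)
    then have "jacobian_matrix S x *v axis 2 1 = (- h (S x) / 2) *s axis 1 1 + axis 2 1"
      by (simp add: JS[OF x(1)] vec_eq_iff forall_2 axis_def)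
    then show ?thesis
      by (simp only: rep(2)[OF that] matrix_vector_mul_assoc[symmetric] matrix_vector_right_distrib
          vector_scalar_commute e[OF x(2)] w_def)
  qed
  have ee: "eta_form u F (\<phi>2 x) (axis u 1) (axis u 1) = 0"
    and ew: "eta_form u F (\<phi>2 x) (axis u 1) (jacobian_matrix \<phi>2 x *v axis 2 1) = 1"
    and ww: "eta_form u F (\<phi>2 x) (jacobian_matrix \<phi>2 x *v axis 2 1) (jacobian_matrix \<phi>2 x *v axis 2 1) = 0"
    if "x \<in> W" for x
  proof -
    have x: "S x \<in> B" using SW that by auto
    have t: "\<phi>2 x \<in> M" using inM[OF x] by (simp add: \<phi>2_def)
    show ee: "eta_form u F (\<phi>2 x) (axis u 1) (axis u 1) = 0"
      unfolding eta_form_unity[OF t] using du by (simp add: axis_def)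
    have ew1: "eta_form u F (\<phi>2 x) (axis u 1) (w (S x)) = 1"
      by (simp add: eta_form_unity[OF t] w[OF x])
    define \<kappa> where "\<kappa> = - h (S x) / 2"
    have J: "jacobian_matrix \<phi>2 x *v axis 2 1 = \<kappa> *s axis u 1 + w (S x)"
      unfolding \<kappa>_def by (rule J2[OF that])
    show "eta_form u F (\<phi>2 x) (axis u 1) (jacobian_matrix \<phi>2 x *v axis 2 1) = 1"
      by (simp add: J eta_form_linear ee ew1)
    have "eta_form u F (\<phi>2 x) (w (S x)) (axis u 1) = 1"
      using ew1 eta_form_sym[OF t] by metis
    moreover have "eta_form u F (\<phi>2 x) (w (S x)) (w (S x)) = h (S x)"
      by (simp add: h_def \<phi>2_def)
    ultimately have "eta_form u F (\<phi>2 x) (jacobian_matrix \<phi>2 x *v axis 2 1) (jacobian_matrix \<phi>2 x *v axis 2 1)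
        = 2 * \<kappa> + h (S x)"
      by (simp add: J eta_form_linear ee ew1)
    then show "eta_form u F (\<phi>2 x) (jacobian_matrix \<phi>2 x *v axis 2 1) (jacobian_matrix \<phi>2 x *v axis 2 1) = 0"
      by (simp add: \<kappa>_def)
  qed
  have "\<phi>2 y0 = \<phi>0 x0" by (simp add: \<phi>2_def \<open>S y0 = y0\<close> \<phi>y0)
  from that[OF r'(1) rep(1)[unfolded W_def] this J1[unfolded W_def] ee[unfolded W_def] ew[unfolded W_def] ww[unfolded W_def]]
  show thesis .
qed

end

theorem proposition2:
  fixes M N :: "('k::{real_normed_field, euclidean_space} ^ 'm::finite) set"
    and F :: "'k ^ 'm \<Rightarrow> 'k"
    and u :: 'm
    and \<iota> :: "'m \<Rightarrow> nat"
  assumes "frobenius_manifold M u F"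
    and "antidiagonal_coordinates \<iota> M u F"
    and "N \<subseteq> M"
    and "submanifold TYPE(2) N"
    and "\<forall>p\<in>N. nondegenerate_on (tangent_space N p) (eta_form u F p)"
    and "\<forall>p\<in>N. axis u 1 \<in> tangent_space N p"
  shows "induced_frobenius_manifold u F N (1::2)"
proof -
  interpret unity_tangent_surface M u F N \<iota>
    using assms by unfold_locales blast+
  show ?thesis
    unfolding induced_frobenius_manifold_def
  proof
    fix p assume "p \<in> N"
    then obtain U0 and \<phi>0 :: "'k ^ 2 \<Rightarrow> 'k ^ 'm" and x0 where lp0: "local_parametrization N U0 \<phi>0" and x0: "x0 \<in> U0" and p0: "p = \<phi>0 x0"
      using assms(4) unfolding submanifold_def by blast
    obtain y0 r and \<phi> :: "'k ^ 2 \<Rightarrow> 'k ^ 'm" where r: "r > 0" and lp: "local_parametrization N (ball y0 r) \<phi>" and p: "\<phi> y0 = \<phi>0 x0"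
      and e: "\<And>y. y \<in> ball y0 r \<Longrightarrow> jacobian_matrix \<phi> y *v axis 1 1 = axis u 1"
      and ee: "\<And>y. y \<in> ball y0 r \<Longrightarrow> eta_form u F (\<phi> y) (axis u 1) (axis u 1) = 0"
      and ew: "\<And>y. y \<in> ball y0 r \<Longrightarrow> eta_form u F (\<phi> y) (axis u 1) (jacobian_matrix \<phi> y *v axis 2 1) = 1"
      and ww: "\<And>y. y \<in> ball y0 r \<Longrightarrow>
         eta_form u F (\<phi> y) (jacobian_matrix \<phi> y *v axis 2 1) (jacobian_matrix \<phi> y *v axis 2 1) = 0"
    proof (rule null_parametrization[OF lp0 x0], goal_cases)
      case (1 y0 r \<phi>)
      show ?case by (rule 1(1)) (fact 1)+
    qed
    define B where "B = ball y0 r"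
    note U = local_parametrizationD[OF lp, folded B_def]
    define w where "w = (\<lambda>y. jacobian_matrix \<phi> y *v axis 2 1)"
    define c where "c = (\<lambda>y. c_form F (\<phi> y) (w y) (w y) (w y))"
    have "constant_along_on 1 (ball y0 r) c"
      unfolding c_def w_def by (rule c_form_constant_along_unity[OF lp e])
    from exists_prepotential_2[OF r this]
    obtain G where G: "frobenius_manifold B 1 G"
      and etaG: "\<And>x. x \<in> B \<Longrightarrow> eta 1 G x = (\<chi> i j. if i = j then 0 else 1)"
      and multG: "\<And>x a b. x \<in> B \<Longrightarrow>
        mult 1 G x a b = (a $ 1 * b $ 1 + c x * a $ 2 * b $ 2) *s axis 1 1 + (a $ 1 * b $ 2 + a $ 2 * b $ 1) *s axis 2 1"
      unfolding B_def by metis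
    have main: "let d\<phi> = \<lambda>a. jacobian_matrix \<phi> x *v a
       in (\<forall>a b. eta_form u F (\<phi> x) (d\<phi> a) (d\<phi> b) = eta_form 1 G x a b) \<and>
          (\<forall>a b. induced_mult u F N (\<phi> x) (d\<phi> a) (d\<phi> b) = d\<phi> (mult 1 G x a b)) \<and>
          d\<phi> (axis 1 1) = axis u 1" if "x \<in> B" for x
    proof -
      define d\<phi> where "d\<phi> = (\<lambda>a. jacobian_matrix \<phi> x *v a)"
      have xB: "x \<in> ball y0 r" using that by (simp add: B_def)
      have pN: "\<phi> x \<in> N" using U(5) that by blast
      then have t: "\<phi> x \<in> M" using N_sub by blast
      have d: "d\<phi> a = a $ 1 *s axis u 1 + a $ 2 *s w x" for a
        using matrix_vector_mult_2[of "jacobian_matrix \<phi> x" a] by (simp add: d\<phi>_def e[OF xB] w_def)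
      have ee': "eta_form u F (\<phi> x) (axis u 1) (axis u 1) = 0"
        and ew': "eta_form u F (\<phi> x) (axis u 1) (w x) = 1"
        and ww': "eta_form u F (\<phi> x) (w x) (w x) = 0"
        using ee[OF xB] ew[OF xB] ww[OF xB] by (simp_all add: w_def)
      have "eta_form u F (\<phi> x) (w x) (axis u 1) = 1"
        using ew' eta_form_sym[OF t] by metis
      then have eta: "eta_form u F (\<phi> x) (d\<phi> a) (d\<phi> b) = a $ 1 * b $ 2 + a $ 2 * b $ 1" for a b
        unfolding d by (simp add: eta_form_linear ee' ew' ww')
      have "eta_form 1 G x a b = a $ 1 * b $ 2 + a $ 2 * b $ 1" for a b
        by (simp add: eta_form_def etaG[OF that] sum_2)
      \<comment> \<open>The product given by \<open>G\<close> is tangent and has the same metric pairings with tangent vectors as the product of \<open>M\<close>.\<close>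
      moreover have "induced_mult u F N (\<phi> x) (d\<phi> a) (d\<phi> b) = d\<phi> (mult 1 G x a b)" for a b
        unfolding induced_mult_def
      proof (rule orthogonal_proj_eqI[OF nondegenerate[OF pN]])
        have T: "tangent_space N (\<phi> x) = range d\<phi>"
          unfolding d\<phi>_def by (rule tangent_space_eq_range[OF lp xB])
        show "a - b \<in> tangent_space N (\<phi> x)" if "a \<in> tangent_space N (\<phi> x)" "b \<in> tangent_space N (\<phi> x)" for a b
          using that unfolding T d\<phi>_def by (auto simp flip: matrix_vector_mult_diff_distrib)
        show "d\<phi> (mult 1 G x a b) \<in> tangent_space N (\<phi> x)" unfolding T by blast
        show "eta_form u F (\<phi> x) (mult u F (\<phi> x) (d\<phi> a) (d\<phi> b)) v = eta_form u F (\<phi> x) (d\<phi> (mult 1 G x a b)) v"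
          if "v \<in> tangent_space N (\<phi> x)" for v
        proof -
          obtain v' where v: "v = d\<phi> v'" using \<open>v \<in> tangent_space N (\<phi> x)\<close> unfolding T by blast
          have "eta_form u F (\<phi> x) (mult u F (\<phi> x) (d\<phi> a) (d\<phi> b)) v
              = (a $ 1 * b $ 1 + c x * a $ 2 * b $ 2) * v' $ 2 + (a $ 1 * b $ 2 + a $ 2 * b $ 1) * v' $ 1"
            unfolding eta_form_mult[OF t] v d c_def by (rule c_form_null_frame[OF t ee' ew' ww'])
          also have "\<dots> = eta_form u F (\<phi> x) (d\<phi> (mult 1 G x a b)) v"
            unfolding v eta multG[OF \<open>x \<in> B\<close>] by (simp add: axis_def)
          finally show ?thesis .
        qed
      qed (rule eta_form_linear)
      ultimately show ?thesis
        unfolding Let_def d\<phi>_def[symmetric] using eta e[OF xB] by (simp add: d\<phi>_def)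
    qed
    have "p \<in> \<phi> ` B"
      using r by (intro image_eqI[of _ _ y0]) (simp_all add: p p0 B_def)
    with lp G main show "\<exists>(U :: ('k ^ 2) set) \<phi> G.
        local_parametrization N U \<phi> \<and> p \<in> \<phi> ` U \<and> frobenius_manifold U 1 G \<and>
        (\<forall>x\<in>U.
           let d\<phi> = (\<lambda>a. jacobian_matrix \<phi> x *v a) in
             (\<forall>a b. eta_form u F (\<phi> x) (d\<phi> a) (d\<phi> b) = eta_form 1 G x a b) \<and>
             (\<forall>a b. induced_mult u F N (\<phi> x) (d\<phi> a) (d\<phi> b) = d\<phi> (mult 1 G x a b)) \<and>
             d\<phi> (axis 1 1) = axis u 1)"
      unfolding B_def by blast
  qed
qed

end
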